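(* Let $n\ge 1$ and $N\ge 1$ be integers and let $0=\nu_1\le \nu_2\le\cdots\le\nu_n$ be integers. Then for every $z\in\mathbb{C}$, $$\omega_{n,N}(z)=\frac{\pi^{n-1}}{\prod_{i=1}^n\Gamma(\nu_i+N+1)}\;G_{n,n}^{n,n}\left(\begin{matrix}-N,\ldots,-N\\ 0,\nu_2,\nu_3,\ldots,\nu_n\end{matrix}\;\Big|\;|z|^2\right).$$
   Context: The weight $\omega_{n,N}$ (which depends also on $\nu_1,\dots,\nu_n$) is defined by $$\omega_{n,N}(z)=\int_{\mathbb{C}^n}\prod_{j=1}^n\frac{|x_j|^{2\nu_j}}{(1+|x_j|^2)^{\nu_j+N+1}}\;\delta\Big(z-\prod_{j=1}^n x_j\Big)\,d^2x_1\cdots d^2x_n ,$$ where $d^2x$ is Lebesgue measure on $\mathbb{C}$ and $\delta$ is the Dirac delta on $\mathbb{C}$. (For $n=1$, $\omega_{1,N}(z)=(1+|z|^2)^{-N-1}$.) In the random matrix setting, $N=N_1\le\cdots\le N_{n+1}$, $\nu_i=N_i-N$, and $\omega_{n,N}$ is the weight in the joint eigenvalue density of a product of $n$ independent Cauchy-Lorentz matrices of sizes $N_i\times N_{i+1}$. $G_{n,n}^{n,n}$ is the Meijer G-function, given by the Mellin-Barnes integral $$G_{n,n}^{n,n}\left(\begin{matrix}a_1,\ldots,a_n\\ b_1,\ldots,b_n\end{matrix}\Big|\,x\right)=\frac1{2\pi i}\int_{c-i\infty}^{c+i\infty}\prod_{j=1}^n\Gamma(b_j+s)\,\Gamma(1-a_j-s)\;x^{-s}\,ds,$$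 with $c$ real such that the poles of the $\Gamma(b_j+s)$ lie to the left and the poles of the $\Gamma(1-a_j-s)$ to the right of the contour (in the case at hand, $0<c<N+1$). *)

theory Defs
  imports "HOL-Analysis.Analysis"
begin

text \<open>
  The Dirac delta on \<open>\<complex>\<close> under an integral sign is read as the limit of all nascent deltas
  \<open>\<eta>\<^sub>\<epsilon>(w) = \<epsilon>\<^sup>-\<^sup>2 \<eta>(w/\<epsilon>)\<close>, where \<open>\<eta>\<close> is any nonnegative continuous function with compact support
  and total mass 1 (\<open>\<complex>\<close> has real dimension 2).
\<close>

definition mollifier :: "(complex \<Rightarrow> real) \<Rightarrow> bool" where
  "mollifier \<eta> \<longleftrightarrow>
     continuous_on UNIV \<eta> \<and> (\<forall>w. 0 \<le> \<eta> w) \<and> (\<exists>R. \<forall>w. R < norm w \<longrightarrow> \<eta> w = 0) \<and>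
     (\<integral>\<^sup>+w. ennreal (\<eta> w) \<partial>lborel) = 1"

text \<open>
  \<open>has_delta_integral M f \<Phi> z L\<close> says that \<open>\<integral> f(x) \<delta>(z - \<Phi>(x)) dM(x) = L\<close>, for \<open>f \<ge> 0\<close>.
  The value lies in \<open>[0, \<infinity>]\<close>: the delta integral defining the weight below
  diverges at \<open>z = 0\<close> as soon as two of the \<open>\<nu>\<^sub>j\<close> vanish.
\<close>

definition has_delta_integral ::
    "'a measure \<Rightarrow> ('a \<Rightarrow> real) \<Rightarrow> ('a \<Rightarrow> complex) \<Rightarrow> complex \<Rightarrow> ennreal \<Rightarrow> bool" where
  "has_delta_integral M f \<Phi> z L \<longleftrightarrow>
     (\<forall>\<eta>. mollifier \<eta> \<longrightarrow>
        ((\<lambda>\<epsilon>. \<integral>\<^sup>+x. ennreal (f x * (\<eta> ((z - \<Phi> x) / complex_of_real \<epsilon>) / \<epsilon>\<^sup>2)) \<partial>M) \<longlongrightarrow> L)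
          (at_right 0))"

definition delta_integral ::
    "'a measure \<Rightarrow> ('a \<Rightarrow> real) \<Rightarrow> ('a \<Rightarrow> complex) \<Rightarrow> complex \<Rightarrow> ennreal" where
  "delta_integral M f \<Phi> z = (THE L. has_delta_integral M f \<Phi> z L)"

lemma mollifier_exists: "\<exists>\<eta>. mollifier \<eta>"
proof -
  define h :: "complex \<Rightarrow> real" where "h = (\<lambda>w. max 0 (1 - norm w))"
  define I where "I = (\<integral>\<^sup>+w. ennreal (h w) \<partial>lborel)"
  have cont: "continuous_on UNIV h"
    unfolding h_def by (intro continuous_intros)
  have [measurable]: "h \<in> borel_measurable borel"
    using cont by (rule borel_measurable_continuous_onI)
  have "I \<le> (\<integral>\<^sup>+w. indicator (cball 0 1 :: complex set) w \<partial>lborel)"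
    unfolding I_def by (intro nn_integral_mono) (auto simp: h_def indicator_def)
  also have "\<dots> < \<infinity>"
    using emeasure_bounded_finite[OF bounded_cball, of "0::complex" 1] by simp
  finally have fin: "I < \<infinity>" .
  have "I \<noteq> 0"
  proof
    assume "I = 0"
    hence "AE w in lborel. ennreal (h w) = 0"
      unfolding I_def by (subst (asm) nn_integral_0_iff_AE) auto
    hence "AE w in lborel. w \<notin> (ball 0 1 :: complex set)"
      by eventually_elim (auto simp: h_def ennreal_eq_0_iff)
    hence "emeasure lborel (ball 0 1 :: complex set) = 0"
      by (subst (asm) AE_iff_measurable[where N = "ball 0 1"]) auto
    hence "negligible (ball 0 1 :: complex set)"
      by (simp add: negligible_iff_emeasure0 emeasure_completion)
    thus False
      using open_not_negligible[of "ball 0 1 :: complex set"] by simp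
  qed
  then obtain r where r: "I = ennreal r" "r > 0"
    using fin by (cases I) (auto simp: ennreal_eq_0_iff less_le)
  have "(\<integral>\<^sup>+w. ennreal (h w / r) \<partial>lborel) = (\<integral>\<^sup>+w. ennreal (1 / r) * ennreal (h w) \<partial>lborel)"
    using r by (intro nn_integral_cong) (simp flip: ennreal_mult' add: h_def)
  also have "\<dots> = ennreal (1 / r) * I"
    unfolding I_def by (intro nn_integral_cmult) auto
  also have "\<dots> = 1"
    using r by (simp flip: ennreal_mult')
  finally have "(\<integral>\<^sup>+w. ennreal (h w / r) \<partial>lborel) = 1" .
  moreover have "continuous_on UNIV (\<lambda>w. h w / r)"
    using cont r by (intro continuous_intros) auto
  moreover have "\<forall>w. 1 < norm w \<longrightarrow> h w / r = 0" "\<forall>w. 0 \<le> h w / r"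
    using r by (auto simp: h_def)
  ultimately have "mollifier (\<lambda>w. h w / r)"
    unfolding mollifier_def by blast
  thus ?thesis by (rule exI[of mollifier])
qed

lemma has_delta_integral_unique:
  assumes "has_delta_integral M f \<Phi> z L" "has_delta_integral M f \<Phi> z L'"
  shows "L = L'"
proof -
  obtain \<eta> where "mollifier \<eta>"
    using mollifier_exists ..
  with assms show ?thesis
    unfolding has_delta_integral_def by (auto intro: tendsto_unique[OF trivial_limit_at_right_real])
qed

lemma delta_integral_eqI: "has_delta_integral M f \<Phi> z L \<Longrightarrow> delta_integral M f \<Phi> z = L"
  unfolding delta_integral_def by (blast intro: has_delta_integral_unique)

abbreviation lebesgue_Cn :: "nat \<Rightarrow> (nat \<Rightarrow> complex) measure" where
  "lebesgue_Cn n \<equiv> PiM {1..n} (\<lambda>_. lborel)"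

definition weight_integrand :: "nat \<Rightarrow> nat \<Rightarrow> (nat \<Rightarrow> nat) \<Rightarrow> (nat \<Rightarrow> complex) \<Rightarrow> real" where
  "weight_integrand n N \<nu> x =
     (\<Prod>j=1..n. norm (x j) ^ (2 * \<nu> j) / (1 + (norm (x j))\<^sup>2) ^ (\<nu> j + N + 1))"

definition weight :: "nat \<Rightarrow> nat \<Rightarrow> (nat \<Rightarrow> nat) \<Rightarrow> complex \<Rightarrow> ennreal" where
  "weight n N \<nu> z =
     delta_integral (lebesgue_Cn n) (weight_integrand n N \<nu>) (\<lambda>x. \<Prod>j=1..n. x j) z"

text \<open>
  The line \<open>Re s = c\<close> has the poles \<open>-b\<^sub>j - k\<close> of \<open>\<Gamma>(b\<^sub>j + s)\<close> to its left and the poles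
  \<open>1 - a\<^sub>j + k\<close> of \<open>\<Gamma>(1 - a\<^sub>j - s)\<close> to its right.
\<close>

definition separating_line ::
    "nat \<Rightarrow> (nat \<Rightarrow> complex) \<Rightarrow> (nat \<Rightarrow> complex) \<Rightarrow> real \<Rightarrow> bool" where
  "separating_line n a b c \<longleftrightarrow>
     (\<forall>j\<in>{1..n}. \<forall>k::nat. Re (- b j - of_nat k) < c \<and> c < Re (1 - a j + of_nat k))"

text \<open>
  The Meijer function \<open>G\<close> with all four orders equal to \<open>n\<close>, as a Mellin-Barnes integral along
  \<open>s = c + i t\<close>, so that \<open>ds = i dt\<close>. Only meaningful for \<open>x > 0\<close> (in HOL,
  \<open>0 powr (-s) = 0\<close>); the value at \<open>x = 0\<close> has to be taken as the limit \<open>x \<rightarrow> 0+\<close>.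
\<close>

definition meijer_G ::
    "nat \<Rightarrow> (nat \<Rightarrow> complex) \<Rightarrow> (nat \<Rightarrow> complex) \<Rightarrow> real \<Rightarrow> real \<Rightarrow> complex" where
  "meijer_G n a b c x =
     1 / (2 * of_real pi * \<i>) *
     (\<integral>t. (let s = Complex c t in
            (\<Prod>j=1..n. Gamma (b j + s) * Gamma (1 - a j - s)) * of_real x powr (- s) * \<i>) \<partial>lborel)"

end

theory Submission
  imports Defs "HOL-Probability.Levy" "HOL-Probability.Convolution"
begin

text \<open>
  The weight is the density of the image of \<open>\<Prod>\<^sub>j f\<^sub>j(|x\<^sub>j|\<^sup>2) d\<^sup>2x\<^sub>j\<close> under multiplication; it is a radial function
  \<open>W(|z|\<^sup>2)\<close>, obtained by iterated multiplicative convolution. Since \<open>\<nu>\<^sub>1 = 0\<close>, the first factor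
  \<open>f\<^sub>1(r) = (1 + r)\<^bsup>-N-1\<^esup>\<close> is decreasing and satisfies \<open>f\<^sub>1(r) \<le> l\<^bsup>N+1\<^esup> f\<^sub>1(l r)\<close> for \<open>l \<ge> 1\<close>. Both properties
  pass to \<open>W\<close>; together they give continuity on \<open>r > 0\<close> and a limit in \<open>[0, \<infinity>]\<close> at \<open>0\<close>, so every
  nascent delta converges to the same value.

  In the coordinate \<open>y = ln r\<close>, multiplicative convolution becomes convolution on the line, and the
  Fourier transform of \<open>exp(c y) W(exp y)\<close> is \<open>1/\<pi>\<close> times the product of the Beta integrals
  \<open>\<pi> \<Gamma>(\<nu>\<^sub>j + s) \<Gamma>(N + 1 - s) / \<Gamma>(\<nu>\<^sub>j + N + 1)\<close> with \<open>s = c + i t\<close>. It decays quadratically, so Levy's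
  inversion theorem recovers \<open>W\<close> from it, and the inversion integral is the Mellin-Barnes integral.
\<close>

section \<open>Integration over the complex plane\<close>

lemma borel_measurable_Complex [measurable]:
  assumes [measurable]: "f \<in> borel_measurable M" "g \<in> borel_measurable M"
  shows "(\<lambda>x. Complex (f x) (g x)) \<in> borel_measurable M"
  unfolding Complex_eq by measurable

lemma lborel_complex_eq_distr_pair:
  "(lborel :: complex measure) = distr (lborel \<Otimes>\<^sub>M lborel) borel (\<lambda>(x, y). Complex x y)"
proof (rule lborel_eqI)
  fix l u :: complex assume le: "\<And>b. b \<in> Basis \<Longrightarrow> l \<bullet> b \<le> u \<bullet> b"
  have [simp]: "Re l \<le> Re u" "Im l \<le> Im u"
    using le[of 1] le[of \<i>] by (auto simp: Basis_complex_def)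
  have "(\<lambda>(x, y). Complex x y) -` box l u = {Re l <..< Re u} \<times> {Im l <..< Im u}"
    by (auto simp: box_def Basis_complex_def)
  then show "emeasure (distr (lborel \<Otimes>\<^sub>M lborel) borel (\<lambda>(x, y). Complex x y)) (box l u)
      = (\<Prod>b\<in>Basis. (u - l) \<bullet> b)"
    by (simp add: emeasure_distr space_pair_measure lborel.emeasure_pair_measure_Times
        ennreal_mult Basis_complex_def)
qed simp

lemma nn_integral_complex_iterated:
  fixes H :: "complex \<Rightarrow> ennreal"
  assumes [measurable]: "H \<in> borel_measurable borel"
  shows "(\<integral>\<^sup>+w. H w \<partial>lborel) = (\<integral>\<^sup>+x. \<integral>\<^sup>+y. H (Complex x y) \<partial>lborel \<partial>lborel)"
    and "(\<integral>\<^sup>+w. H w \<partial>lborel) = (\<integral>\<^sup>+y. \<integral>\<^sup>+x. H (Complex x y) \<partial>lborel \<partial>lborel)"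
proof -
  show 1: "(\<integral>\<^sup>+w. H w \<partial>lborel) = (\<integral>\<^sup>+x. \<integral>\<^sup>+y. H (Complex x y) \<partial>lborel \<partial>lborel)"
    by (simp add: lborel_complex_eq_distr_pair nn_integral_distr lborel.nn_integral_fst [symmetric])
  show "(\<integral>\<^sup>+w. H w \<partial>lborel) = (\<integral>\<^sup>+y. \<integral>\<^sup>+x. H (Complex x y) \<partial>lborel \<partial>lborel)"
    unfolding 1 by (rule lborel_pair.Fubini') simp
qed

text \<open>As a real-linear map of the plane, multiplication by \<open>a\<close> has determinant
  |a|^2. The formula is assembled from one-variable affine substitutions and Tonelli.\<close>

lemma nn_integral_complex_affine:
  fixes H :: "complex \<Rightarrow> ennreal"
  assumes [measurable]: "H \<in> borel_measurable borel" and "a \<noteq> 0"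
  shows "(\<integral>\<^sup>+w. H w \<partial>lborel) = ennreal ((norm a)\<^sup>2) * (\<integral>\<^sup>+w. H (a * w + b) \<partial>lborel)"
proof -
  define p q s t where "p = Re a" "q = Im a" "s = Re b" "t = Im b"
  note defs = this
  have nrm: "(norm a)\<^sup>2 = p\<^sup>2 + q\<^sup>2"
    by (simp add: cmod_power2 defs)
  have eq: "H (a * Complex x y + b) = H (Complex (p * x - q * y + s) (q * x + p * y + t))" for x y
    by (rule arg_cong[of _ _ H]) (simp add: complex_eq_iff defs)
  show ?thesis
  \<comment> \<open>For \<open>p = 0\<close> the map is a scaled quarter turn, so each output
    coordinate depends on a single input coordinate. Otherwise the imaginary part is substituted
    first, at fixed output real part, and the real part afterwards.\<close>
  proof (cases "p = 0")
    case True
    with \<open>a \<noteq> 0\<close> have "q \<noteq> 0" by (auto simp: defs complex_eq_iff)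
    have "(\<integral>\<^sup>+w. H w \<partial>lborel) = (\<integral>\<^sup>+x. \<integral>\<^sup>+y. H (Complex x y) \<partial>lborel \<partial>lborel)"
      by (rule nn_integral_complex_iterated) simp
    also have "\<dots> = ennreal \<bar>q\<bar> * (\<integral>\<^sup>+y. \<integral>\<^sup>+v. H (Complex (s - q * y) v) \<partial>lborel \<partial>lborel)"
      using \<open>q \<noteq> 0\<close> by (subst nn_integral_real_affine[where c = "-q" and t = s]) auto
    also have "\<dots> = ennreal \<bar>q\<bar> * (\<integral>\<^sup>+y. ennreal \<bar>q\<bar> *
        (\<integral>\<^sup>+x. H (Complex (s - q * y) (t + q * x)) \<partial>lborel) \<partial>lborel)"
      using \<open>q \<noteq> 0\<close>
      by (intro arg_cong[of _ _ "(*) (ennreal \<bar>q\<bar>)"] nn_integral_cong nn_integral_real_affine) auto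
    also have "\<dots> = ennreal (q\<^sup>2) *
        (\<integral>\<^sup>+y. \<integral>\<^sup>+x. H (Complex (s - q * y) (t + q * x)) \<partial>lborel \<partial>lborel)"
      by (simp add: nn_integral_cmult power2_eq_square flip: mult.assoc ennreal_mult')
    also have "\<dots> = ennreal ((norm a)\<^sup>2) * (\<integral>\<^sup>+w. H (a * w + b) \<partial>lborel)"
    proof -
      have "H (Complex (s - q * y) (t + q * x)) = H (a * Complex x y + b)" for x y
        unfolding eq by (simp add: True add.commute)
      then show ?thesis
        by (subst nn_integral_complex_iterated(2)[of "\<lambda>w. H (a * w + b)"]) (simp_all add: nrm True)
    qed
    finally show ?thesis .
  next
    case False
    have nz: "q\<^sup>2 / p + p \<noteq> 0"
      using False by (simp add: field_simps add_nonneg_eq_0_iff power2_eq_square)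
    have "(\<integral>\<^sup>+w. H w \<partial>lborel) = (\<integral>\<^sup>+x. \<integral>\<^sup>+v. H (Complex x v) \<partial>lborel \<partial>lborel)"
      by (rule nn_integral_complex_iterated) simp
    \<comment> \<open>Eliminating the input real part from the pair (p x - q y + s, q x + p y + t)
      leaves the slope q^2/p + p in y. Its product with the second Jacobian factor p is p^2 +
      q^2.\<close>
    also have "\<dots> = (\<integral>\<^sup>+x. ennreal \<bar>q\<^sup>2 / p + p\<bar> * (\<integral>\<^sup>+y.
        H (Complex x ((q * x / p - q * s / p + t) + (q\<^sup>2 / p + p) * y)) \<partial>lborel) \<partial>lborel)"
      using nz by (intro nn_integral_cong nn_integral_real_affine) auto
    also have "\<dots> = ennreal \<bar>q\<^sup>2 / p + p\<bar> * (\<integral>\<^sup>+x. \<integral>\<^sup>+y.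
        H (Complex x ((q * x / p - q * s / p + t) + (q\<^sup>2 / p + p) * y)) \<partial>lborel \<partial>lborel)"
      by (rule nn_integral_cmult) simp
    also have "(\<integral>\<^sup>+x. \<integral>\<^sup>+y.
        H (Complex x ((q * x / p - q * s / p + t) + (q\<^sup>2 / p + p) * y)) \<partial>lborel \<partial>lborel) =
      (\<integral>\<^sup>+y. \<integral>\<^sup>+x.
        H (Complex x ((q * x / p - q * s / p + t) + (q\<^sup>2 / p + p) * y)) \<partial>lborel \<partial>lborel)"
      by (rule lborel_pair.Fubini') simp
    also have "\<dots> = (\<integral>\<^sup>+y. ennreal \<bar>p\<bar> * (\<integral>\<^sup>+x. H (Complex ((s - q * y) + p * x)
        ((q * ((s - q * y) + p * x) / p - q * s / p + t) + (q\<^sup>2 / p + p) * y)) \<partial>lborel) \<partial>lborel)"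
      using False by (intro nn_integral_cong nn_integral_real_affine) auto
    also have "\<dots> = ennreal \<bar>p\<bar> * (\<integral>\<^sup>+y. \<integral>\<^sup>+x. H (Complex ((s - q * y) + p * x)
        ((q * ((s - q * y) + p * x) / p - q * s / p + t) + (q\<^sup>2 / p + p) * y)) \<partial>lborel \<partial>lborel)"
      by (rule nn_integral_cmult) simp
    also have "(\<integral>\<^sup>+y. \<integral>\<^sup>+x. H (Complex ((s - q * y) + p * x)
        ((q * ((s - q * y) + p * x) / p - q * s / p + t) + (q\<^sup>2 / p + p) * y)) \<partial>lborel \<partial>lborel) =
        (\<integral>\<^sup>+y. \<integral>\<^sup>+x. H (a * Complex x y + b) \<partial>lborel \<partial>lborel)"
      unfolding eq using False
      by (intro nn_integral_cong arg_cong[of _ _ H]) (simp add: field_simps power2_eq_square)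
    also have "\<dots> = (\<integral>\<^sup>+w. H (a * w + b) \<partial>lborel)"
      by (subst nn_integral_complex_iterated(2)[of "\<lambda>w. H (a * w + b)"]) simp_all
    also have "ennreal \<bar>q\<^sup>2 / p + p\<bar> * (ennreal \<bar>p\<bar> * (\<integral>\<^sup>+w. H (a * w + b) \<partial>lborel)) =
        ennreal (\<bar>q\<^sup>2 / p + p\<bar> * \<bar>p\<bar>) * (\<integral>\<^sup>+w. H (a * w + b) \<partial>lborel)"
      by (simp add: ennreal_mult mult.assoc)
    also have "\<bar>q\<^sup>2 / p + p\<bar> * \<bar>p\<bar> = (norm a)\<^sup>2"
    proof -
      have "(q\<^sup>2 / p + p) * p = (norm a)\<^sup>2"
        unfolding nrm using False by (simp add: field_simps power2_eq_square)
      then show ?thesis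
        unfolding abs_mult[symmetric] by simp
    qed
    finally show ?thesis .
  qed
qed

section \<open>Logarithmic polar coordinates and the substitution r = exp y\<close>

lemma nn_integral_exp_uminus_greaterThan:
  "(\<integral>\<^sup>+y. ennreal (exp (- y)) * indicator {a<..} y \<partial>lborel) = ennreal (exp (- a))"
proof -
  have "(\<integral>\<^sup>+y. ennreal (exp (- y)) * indicator {a<..} y \<partial>lborel) =
      (\<integral>\<^sup>+y. ennreal (exp (- y)) * indicator {a..} y \<partial>lborel)"
    by (rule nn_integral_cong_AE, use AE_lborel_singleton[of a] in eventually_elim)
      (auto simp: indicator_def)
  also have "\<dots> = ennreal (0 - (- exp (- a)))"
  proof (rule nn_integral_FTC_atLeast)
    show "((\<lambda>y. - exp (- y)) has_real_derivative exp (- y)) (at y)" for y :: real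
      by (auto intro!: derivative_eq_intros)
    show "((\<lambda>y::real. - exp (- y)) \<longlongrightarrow> 0) at_top"
      by real_asymp
  qed auto
  finally show ?thesis by simp
qed

text \<open>Polar coordinates in the variable y = ln |w|^2: the disc of squared radius exp y has
  area pi exp y, and differentiating in y gives the density.\<close>

lemma nn_integral_radial:
  fixes H :: "real \<Rightarrow> ennreal"
  assumes [measurable]: "H \<in> borel_measurable borel"
  shows "(\<integral>\<^sup>+w. H (2 * ln (norm (w::complex))) \<partial>lborel) = (\<integral>\<^sup>+y. ennreal (pi * exp y) * H y \<partial>lborel)"
proof -
  have ball: "emeasure lborel (ball (0::complex) r) = ennreal (pi * r\<^sup>2)" if "r \<ge> 0" for r
    using emeasure_ball[of r "0::complex"] that by (simp add: unit_ball_vol_2)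
  have tail: "emeasure lborel {w::complex. x < - 2 * ln (norm w)} = ennreal (pi * exp (- x))" for x
  proof -
    have "emeasure lborel {w::complex. x < - 2 * ln (norm w)} =
        emeasure lborel (ball (0::complex) (exp (- x / 2)))"
    proof (rule emeasure_eq_AE)
      \<comment> \<open>The origin, where \<open>ln\<close> takes a default value, is discarded as a
        null set.\<close>
      show "AE w in lborel. w \<in> {w::complex. x < - 2 * ln (norm w)} \<longleftrightarrow> w \<in> ball 0 (exp (- x / 2))"
        using AE_lborel_singleton[of 0]
      proof eventually_elim
        fix w :: complex assume "w \<noteq> 0"
        then have "norm w < exp (- x / 2) \<longleftrightarrow> ln (norm w) < - x / 2"
          by (metis exp_less_cancel_iff exp_ln zero_less_norm_iff)
        then show "w \<in> {w::complex. x < - 2 * ln (norm w)} \<longleftrightarrow> w \<in> ball 0 (exp (- x / 2))"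
          by auto
      qed
    qed auto
    also have "\<dots> = ennreal (pi * exp (- x))"
      by (simp add: ball power2_eq_square flip: exp_add)
    finally show ?thesis .
  qed
  \<comment> \<open>Measures are compared on right tails, which must have finite mass. Under ln
    |w|^2 these tails are infinite, hence the reflection to -ln |w|^2, undone at the end.\<close>
  have "distr lborel borel (\<lambda>w::complex. - 2 * ln (norm w)) = density lborel (\<lambda>y. ennreal (pi * exp (- y)))"
  proof (rule measure_eqI_lessThan)
    fix x :: real
    have D: "emeasure (distr lborel borel (\<lambda>w::complex. - 2 * ln (norm w))) {x<..} = ennreal (pi * exp (- x))"
      using tail[of x] by (simp add: emeasure_distr vimage_def)
    show "emeasure (distr lborel borel (\<lambda>w::complex. - 2 * ln (norm w))) {x<..} < \<infinity>"
      unfolding D by simp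
    have "emeasure (density lborel (\<lambda>y. ennreal (pi * exp (- y)))) {x<..} =
        (\<integral>\<^sup>+y. ennreal pi * (ennreal (exp (- y)) * indicator {x<..} y) \<partial>lborel)"
      by (simp add: emeasure_density ennreal_mult mult.assoc)
    also have "\<dots> = ennreal (pi * exp (- x))"
      by (simp add: nn_integral_cmult nn_integral_exp_uminus_greaterThan ennreal_mult)
    finally show "emeasure (distr lborel borel (\<lambda>w::complex. - 2 * ln (norm w))) {x<..} =
        emeasure (density lborel (\<lambda>y. ennreal (pi * exp (- y)))) {x<..}"
      unfolding D by simp
  qed simp_all
  then have "(\<integral>\<^sup>+y. H (- y) \<partial>distr lborel borel (\<lambda>w::complex. - 2 * ln (norm w))) =
      (\<integral>\<^sup>+y. H (- y) \<partial>density lborel (\<lambda>y. ennreal (pi * exp (- y))))"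
    by simp
  then have "(\<integral>\<^sup>+w. H (2 * ln (norm (w::complex))) \<partial>lborel) =
      (\<integral>\<^sup>+y. ennreal (pi * exp (- y)) * H (- y) \<partial>lborel)"
    by (simp add: nn_integral_distr nn_integral_density)
  also have "\<dots> = (\<integral>\<^sup>+y. ennreal (pi * exp y) * H y \<partial>lborel)"
    by (subst nn_integral_real_affine[where c = "-1" and t = 0]) auto
  finally show ?thesis .
qed

text \<open>The substitution r = exp y, dr = exp y dy, as an identity of measures; it transports
  Euler's integral to the whole line.\<close>

lemma distr_density_exp:
  "distr (density lborel (\<lambda>y. ennreal (exp y))) borel exp = density lborel (indicator {0<..} :: real \<Rightarrow> ennreal)"
proof -
  \<comment> \<open>Right tails of the claimed measure are infinite. The reflected map y -> -exp(-y)
    lands in the negative axis, where the tail above x < 0 has mass -x.\<close>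
  have "distr (density lborel (\<lambda>y. ennreal (exp (- y)))) borel (\<lambda>y. - exp (- y)) =
      density lborel (indicator {..<0} :: real \<Rightarrow> ennreal)"
  proof (rule measure_eqI_lessThan)
    fix x :: real
    have D: "emeasure (density lborel (indicator {..<0::real})) {x<..} = ennreal (- x)"
    proof -
      have "emeasure (density lborel (indicator {..<0::real})) {x<..} =
          (\<integral>\<^sup>+y. indicator {x<..<0} y \<partial>lborel)"
        unfolding emeasure_density[of "indicator {..<0}" lborel "{x<..}", simplified]
        by (intro nn_integral_cong) (auto split: split_indicator)
      also have "\<dots> = ennreal (- x)"
        by (cases "x < 0") (simp_all add: ennreal_neg)
      finally show ?thesis .
    qed
    have "emeasure (distr (density lborel (\<lambda>y. ennreal (exp (- y)))) borel (\<lambda>y. - exp (- y))) {x<..} =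
        (\<integral>\<^sup>+y. ennreal (exp (- y)) * indicator {y. x < - exp (- y)} y \<partial>lborel)"
      by (simp add: emeasure_distr emeasure_density vimage_def)
    also have "\<dots> = ennreal (- x)"
    proof (cases "x < 0")
      case True
      have "x < - exp (- y) \<longleftrightarrow> - ln (- x) < y" for y
      proof -
        have "x < - exp (- y) \<longleftrightarrow> exp (- y) < exp (ln (- x))"
          using True by (simp add: less_minus_iff)
        then show ?thesis
          by (simp only: exp_less_cancel_iff) linarith
      qed
      then have "{y. x < - exp (- y)} = {- ln (- x)<..}"
        by auto
      then show ?thesis
        using True by (simp add: nn_integral_exp_uminus_greaterThan)
    next
      case False
      then have "{y. x < - exp (- y)} = {}"
        by (auto simp: not_less) (smt (verit) exp_gt_zero)
      then show ?thesis
        using False by (simp add: ennreal_neg)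
    qed
    finally show "emeasure (distr (density lborel (\<lambda>y. ennreal (exp (- y)))) borel (\<lambda>y. - exp (- y))) {x<..} =
        emeasure (density lborel (indicator {..<0::real})) {x<..}"
      and "emeasure (distr (density lborel (\<lambda>y. ennreal (exp (- y)))) borel (\<lambda>y. - exp (- y))) {x<..} < \<infinity>"
      unfolding D by simp_all
  qed simp_all
  note flipped = this
  show ?thesis
  proof (rule measure_eqI)
    fix A :: "real set" assume "A \<in> sets (distr (density lborel (\<lambda>y. ennreal (exp y))) borel exp)"
    then have [measurable]: "A \<in> sets borel" by simp
    have "emeasure (distr (density lborel (\<lambda>y. ennreal (exp y))) borel exp) A =
        (\<integral>\<^sup>+y. ennreal (exp y) * indicator A (exp y) \<partial>lborel)"
      by (simp add: nn_integral_distr nn_integral_density flip: nn_integral_indicator)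
    also have "\<dots> = (\<integral>\<^sup>+y. ennreal (exp (- y)) * indicator A (exp (- y)) \<partial>lborel)"
      by (subst nn_integral_real_affine[where c = "-1" and t = 0]) auto
    also have "\<dots> = (\<integral>\<^sup>+y. indicator A (- y) \<partial>distr (density lborel (\<lambda>y. ennreal (exp (- y)))) borel (\<lambda>y. - exp (- y)))"
      by (simp add: nn_integral_distr nn_integral_density)
    also have "\<dots> = (\<integral>\<^sup>+y. indicator {..<0} y * indicator A (- y) \<partial>lborel)"
      by (simp add: flipped nn_integral_density)
    also have "\<dots> = (\<integral>\<^sup>+y. indicator {0<..} y * indicator A y \<partial>lborel)"
      by (subst nn_integral_real_affine[where c = "-1" and t = 0]) (auto simp: indicator_def)
    finally show "emeasure (distr (density lborel (\<lambda>y. ennreal (exp y))) borel exp) A =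
        emeasure (density lborel (indicator {0<..})) A"
      by (simp add: emeasure_density)
  qed simp
qed

section \<open>Characteristic functions of logarithmic Gamma and Beta densities\<close>

text \<open>Fubini for a bounded integrand. The setting is that of finite measures because the
  densities used here have masses such as Gamma values rather than 1.\<close>

lemma char_convolution:
  assumes "finite_measure M" "finite_measure N"
  assumes [measurable_cong]: "sets M = sets borel" "sets N = sets borel"
  shows "char (M \<star> N) t = char M t * char N t"
proof -
  interpret M: finite_measure M by fact
  interpret N: finite_measure N by fact
  interpret P: pair_sigma_finite M N ..
  interpret F: finite_measure "M \<Otimes>\<^sub>M N"
    by (rule finite_measure_pair_measure) unfold_locales
  have int: "integrable (M \<Otimes>\<^sub>M N) (\<lambda>(x, y). iexp (t * (x + y)))"
    by (rule F.integrable_const_bound[of _ 1]) (auto simp: split_beta)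
  have "char (M \<star> N) t = (CLINT p | M \<Otimes>\<^sub>M N. (\<lambda>(x, y). iexp (t * (x + y))) p)"
    unfolding char_def convolution_def by (subst integral_distr) (auto simp: case_prod_unfold)
  also have "\<dots> = (CLINT x | M. CLINT y | N. iexp (t * (x + y)))"
    using P.integral_fst'[OF int] by simp
  also have "\<dots> = char M t * char N t"
    by (simp add: char_def distrib_left exp_add)
  finally show ?thesis .
qed

lemma char_density:
  assumes [measurable]: "f \<in> borel_measurable borel" and "\<And>x. 0 \<le> f x"
  shows "char (density lborel (\<lambda>x. ennreal (f x))) t = (CLBINT x. iexp (t * x) * of_real (f x))"
  unfolding char_def using assms
  by (subst integral_density) (auto simp: scaleR_conv_of_real mult.commute)

text \<open>Euler's integral after t = exp y: the factor dt = exp y dy raises the exponent from z -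
  1 to z.\<close>

lemma has_bochner_integral_log_Gamma:
  assumes "Re z > 0"
  shows "has_bochner_integral lborel (\<lambda>y. exp (z * of_real y - of_real (exp y))) (Gamma z)"
proof -
  let ?f = "\<lambda>t. complex_of_real t powr (z - 1) / of_real (exp t)"
  let ?g = "\<lambda>t. indicator {0<..} t *\<^sub>R ?f t"
  have [measurable]: "?g \<in> borel_measurable borel"
  proof -
    have "?g = (\<lambda>t. indicator {0<..} t *\<^sub>R (exp ((z - 1) * of_real (ln t)) / of_real (exp t)))"
      by (auto simp: powr_def Ln_of_real fun_eq_iff split: split_indicator)
    then show ?thesis by simp
  qed
  have abs: "set_integrable lebesgue {0<..} ?f"
    by (rule absolutely_integrable_Gamma_integral'[OF assms])
  then have int: "integrable lborel ?g"
    unfolding set_integrable_def by (simp add: integrable_completion)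
  have "integral\<^sup>L lborel ?g = set_lebesgue_integral lebesgue {0<..} ?f"
    unfolding set_lebesgue_integral_def by (simp add: integral_completion)
  also have "\<dots> = Gamma z"
    using set_lebesgue_integral_eq_integral(2)[OF abs] Gamma_integral_complex'[OF assms]
    by (simp add: integral_unique)
  finally have eq: "integral\<^sup>L lborel ?g = Gamma z" .
  have ind: "density lborel (indicator {0<..}) = density lborel (\<lambda>x::real. ennreal (indicator {0<..} x))"
    by (simp add: ennreal_indicator)
  have "(\<lambda>x. indicator {0<..} x *\<^sub>R ?g x) = ?g"
    by (auto simp: fun_eq_iff split: split_indicator)
  then have "has_bochner_integral lborel (\<lambda>x. indicator {0<..} x *\<^sub>R ?g x) (Gamma z)"
    using int eq by (simp only: has_bochner_integral_iff)
  then have "has_bochner_integral (density lborel (indicator {0<..})) ?g (Gamma z)"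
    unfolding ind by (intro has_bochner_integral_density) simp_all
  then have "has_bochner_integral (density lborel (\<lambda>y. ennreal (exp y))) (\<lambda>y. ?g (exp y)) (Gamma z)"
    unfolding distr_density_exp[symmetric] by (simp add: has_bochner_integral_iff integrable_distr_eq integral_distr)
  moreover have "?g (exp y) = exp ((z - 1) * of_real y - of_real (exp y))" for y
    by (simp add: powr_def Ln_of_real exp_diff exp_of_real)
  ultimately have "has_bochner_integral lborel (\<lambda>y. exp y *\<^sub>R exp ((z - 1) * of_real y - of_real (exp y))) (Gamma z)"
    by (simp add: has_bochner_integral_iff integrable_density integral_density)
  moreover have "exp y *\<^sub>R exp ((z - 1) * of_real y - of_real (exp y)) = exp (z * of_real y - of_real (exp y))" for y
    by (simp add: scaleR_conv_of_real algebra_simps flip: exp_of_real exp_add)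
  ultimately show ?thesis by simp
qed

text \<open>For z = \<alpha> + i t the factor exp(z y) splits into exp(\<alpha> y), which belongs to
  the density, and the Fourier kernel; t = 0 gives the total mass.\<close>

lemma log_Gamma_density:
  fixes \<alpha> :: real
  assumes "\<alpha> > 0"
  shows "(\<integral>\<^sup>+y. ennreal (exp (\<alpha> * y - exp y)) \<partial>lborel) = ennreal (Gamma \<alpha>)"
    and "char (density lborel (\<lambda>y. ennreal (exp (\<alpha> * y - exp y)))) t = Gamma (Complex \<alpha> t)"
proof -
  have "has_bochner_integral lborel (\<lambda>y. exp (complex_of_real \<alpha> * of_real y - of_real (exp y))) (Gamma (of_real \<alpha>))"
    using has_bochner_integral_log_Gamma[of "complex_of_real \<alpha>"] assms by simp
  then have "has_bochner_integral lborel (\<lambda>y. complex_of_real (exp (\<alpha> * y - exp y))) (of_real (Gamma \<alpha>))"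
    by (simp flip: exp_of_real add: Gamma_complex_of_real)
  then have "has_bochner_integral lborel (\<lambda>y. exp (\<alpha> * y - exp y)) (Gamma \<alpha>)"
    by (simp add: has_bochner_integral_iff complex_of_real_integrable_eq)
  then show "(\<integral>\<^sup>+y. ennreal (exp (\<alpha> * y - exp y)) \<partial>lborel) = ennreal (Gamma \<alpha>)"
    by (simp add: has_bochner_integral_iff nn_integral_eq_integral)
  have "char (density lborel (\<lambda>y. ennreal (exp (\<alpha> * y - exp y)))) t =
      (CLBINT y. exp (Complex \<alpha> t * of_real y - of_real (exp y)))"
    by (subst char_density)
       (auto intro!: Bochner_Integration.integral_cong simp: Complex_eq algebra_simps
         simp flip: exp_of_real exp_add)
  also have "\<dots> = Gamma (Complex \<alpha> t)"
    using has_bochner_integral_log_Gamma[of "Complex \<alpha> t"] assms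
    by (simp add: has_bochner_integral_integral_eq)
  finally show "char (density lborel (\<lambda>y. ennreal (exp (\<alpha> * y - exp y)))) t = Gamma (Complex \<alpha> t)" .
qed

text \<open>A characteristic function is bounded by the total mass.\<close>

lemma norm_Gamma_Complex_le:
  assumes "\<alpha> > 0"
  shows "norm (Gamma (Complex \<alpha> t)) \<le> Gamma \<alpha>"
proof -
  have "norm (Gamma (Complex \<alpha> t)) \<le>
      (\<integral>y. norm (iexp (t * y)) \<partial>density lborel (\<lambda>y. ennreal (exp (\<alpha> * y - exp y))))"
    unfolding log_Gamma_density(2)[OF assms, symmetric] char_def by (rule integral_norm_bound)
  also have "\<dots> = Gamma \<alpha>"
    using assms by (simp add: measure_def emeasure_density log_Gamma_density(1))
  finally show ?thesis .
qed

text \<open>The Beta integral as a convolution: the log-Gamma density \<open>F\<close> for \<alpha>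
  and the reflected one \<open>G\<close> for \<beta> convolve to Gamma(\<alpha> + \<beta>) times the
  log-Beta density, and characteristic functions multiply.\<close>

lemma log_Beta_density:
  fixes \<alpha> \<beta> :: real
  assumes "\<alpha> > 0" "\<beta> > 0"
  defines "D \<equiv> density lborel (\<lambda>x. ennreal (exp (\<alpha> * x) / (1 + exp x) powr (\<alpha> + \<beta>)))"
  shows "finite_measure D"
    and "char D t = Gamma (Complex \<alpha> t) * Gamma (Complex \<beta> (- t)) / of_real (Gamma (\<alpha> + \<beta>))"
proof -
  define k where "k = (\<lambda>x. exp (\<alpha> * x) / (1 + exp x) powr (\<alpha> + \<beta>))"
  have [measurable]: "k \<in> borel_measurable borel"
    by (simp add: k_def)
  have k_nonneg: "0 \<le> k x" for x
    by (simp add: k_def)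
  have D: "D = density lborel (\<lambda>x. ennreal (k x))"
    by (simp add: D_def k_def)
  define F where "F = density lborel (\<lambda>y. ennreal (exp (\<alpha> * y - exp y)))"
  define G where "G = density lborel (\<lambda>y. ennreal (exp (- \<beta> * y - exp (- y))))"
  have fin_F: "finite_measure F"
    by (rule finite_measureI) (use assms in \<open>simp add: F_def emeasure_density log_Gamma_density\<close>)
  have "(\<integral>\<^sup>+y. ennreal (exp (- \<beta> * y - exp (- y))) \<partial>lborel) = ennreal (Gamma \<beta>)"
    using log_Gamma_density(1)[of \<beta>] assms
    by (subst nn_integral_real_affine[where c = "-1" and t = 0]) auto
  then have fin_G: "finite_measure G"
    by (intro finite_measureI) (use assms in \<open>simp add: G_def emeasure_density\<close>)
  have char_G: "char G t = Gamma (Complex \<beta> (- t))"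
  proof -
    have "char G t = (CLBINT y. iexp (t * y) * of_real (exp (- \<beta> * y - exp (- y))))"
      unfolding G_def by (rule char_density) auto
    also have "\<dots> = (CLBINT y. iexp (- t * y) * of_real (exp (\<beta> * y - exp y)))"
      by (subst lborel_integral_real_affine[where c = "-1" and t = 0]) auto
    also have "\<dots> = char (density lborel (\<lambda>y. ennreal (exp (\<beta> * y - exp y)))) (- t)"
      by (subst char_density) auto
    also have "\<dots> = Gamma (Complex \<beta> (- t))"
      using assms by (simp add: log_Gamma_density)
    finally show ?thesis .
  qed
  have dens: "(\<integral>\<^sup>+y. ennreal (exp (\<alpha> * (x - y) - exp (x - y))) * ennreal (exp (- \<beta> * y - exp (- y))) \<partial>lborel) =
      ennreal (Gamma (\<alpha> + \<beta>)) * ennreal (k x)" for x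
  proof -
    \<comment> \<open>The substitution y = L - u merges exp(x - y) + exp(-y) = exp(L - y) into the
      single term exp u, so that one Gamma integral with parameter \<alpha> + \<beta>
      remains.\<close>
    define L where "L = ln (1 + exp x)"
    have pos: "1 + exp x > 0"
      by (simp add: add_pos_pos)
    then have exp_L: "exp L = 1 + exp x"
      unfolding L_def by simp
    have "(\<integral>\<^sup>+y. ennreal (exp (\<alpha> * (x - y) - exp (x - y))) * ennreal (exp (- \<beta> * y - exp (- y))) \<partial>lborel) =
        (\<integral>\<^sup>+u. ennreal (exp (\<alpha> * (x - (L - u)) - exp (x - (L - u)))) *
           ennreal (exp (- \<beta> * (L - u) - exp (- (L - u)))) \<partial>lborel)"
      by (subst nn_integral_real_affine[where c = "-1" and t = L]) auto
    also have "\<dots> = (\<integral>\<^sup>+u. ennreal (exp (\<alpha> * x - (\<alpha> + \<beta>) * L)) * ennreal (exp ((\<alpha> + \<beta>) * u - exp u)) \<partial>lborel)"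
    proof (rule nn_integral_cong)
      fix u
      have "exp (x - (L - u)) + exp (- (L - u)) = exp u * ((1 + exp x) / exp L)"
        by (simp add: exp_diff exp_minus exp_add field_simps)
      then have "exp (x - (L - u)) + exp (- (L - u)) = exp u"
        using pos by (simp add: exp_L)
      then have "\<alpha> * (x - (L - u)) - exp (x - (L - u)) + (- \<beta> * (L - u) - exp (- (L - u))) =
          \<alpha> * x - (\<alpha> + \<beta>) * L + ((\<alpha> + \<beta>) * u - exp u)"
        by (simp add: algebra_simps)
      then show "ennreal (exp (\<alpha> * (x - (L - u)) - exp (x - (L - u)))) *
           ennreal (exp (- \<beta> * (L - u) - exp (- (L - u)))) =
         ennreal (exp (\<alpha> * x - (\<alpha> + \<beta>) * L)) * ennreal (exp ((\<alpha> + \<beta>) * u - exp u))"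
        by (simp only: exp_add[symmetric] ennreal_mult[symmetric] exp_ge_zero)
    qed
    also have "\<dots> = ennreal (exp (\<alpha> * x - (\<alpha> + \<beta>) * L)) * ennreal (Gamma (\<alpha> + \<beta>))"
      using assms by (simp add: nn_integral_cmult log_Gamma_density)
    also have "exp (\<alpha> * x - (\<alpha> + \<beta>) * L) = k x"
      using pos by (simp add: exp_diff powr_def L_def k_def)
    finally show ?thesis by (simp add: mult.commute)
  qed
  have Gam: "Gamma (\<alpha> + \<beta>) > 0"
    using assms by (simp add: Gamma_real_pos)
  have conv: "F \<star> G = density lborel (\<lambda>x. ennreal (Gamma (\<alpha> + \<beta>) * k x))"
  proof -
    have "F \<star> G = density lborel (\<lambda>x. \<integral>\<^sup>+y. ennreal (exp (\<alpha> * (x - y) - exp (x - y))) *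
        ennreal (exp (- \<beta> * y - exp (- y))) \<partial>lborel)"
      using fin_F fin_G unfolding F_def G_def by (intro convolution_density) auto
    then show ?thesis
      unfolding dens using Gam by (simp add: ennreal_mult')
  qed
  have finc: "finite_measure (F \<star> G)"
    by (intro convolution_finite fin_F fin_G) (simp_all add: F_def G_def)
  have "Gamma (\<alpha> + \<beta>) * char D t = char (F \<star> G) t"
    unfolding conv D using Gam k_nonneg by (simp add: char_density mult.left_commute)
  also have "\<dots> = char F t * char G t"
    by (intro char_convolution fin_F fin_G) (simp_all add: F_def G_def)
  also have "\<dots> = Gamma (Complex \<alpha> t) * Gamma (Complex \<beta> (- t))"
    using assms by (simp add: char_G F_def log_Gamma_density)
  finally show "char D t = Gamma (Complex \<alpha> t) * Gamma (Complex \<beta> (- t)) / of_real (Gamma (\<alpha> + \<beta>))"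
    using Gam by (simp add: field_simps)
  \<comment> \<open>\<open>D\<close> inherits finiteness from the convolution, whose mass differs
    only by the positive factor Gamma(\<alpha> + \<beta>).\<close>
  have "ennreal (Gamma (\<alpha> + \<beta>)) * emeasure D (space D) = emeasure (F \<star> G) (space (F \<star> G))"
    unfolding conv D using Gam by (simp add: emeasure_density nn_integral_cmult ennreal_mult')
  also have "\<dots> < \<infinity>"
    using finite_measure.emeasure_finite[OF finc] by (simp add: less_top)
  finally show "finite_measure D"
    using Gam by (intro finite_measureI) (auto simp: ennreal_mult_less_top)
qed

section \<open>Inversion of integrable characteristic functions\<close>

text \<open>Dominated convergence with majorant |g|. Continuity of the inverse transform later
  upgrades equality of interval integrals to pointwise equality.\<close>

lemma continuous_on_fourier_integral:
  fixes g :: "real \<Rightarrow> complex"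
  assumes "integrable lborel g"
  shows "continuous_on UNIV (\<lambda>y. CLBINT t. iexp (- (t * y)) * g t)"
proof (unfold continuous_on_sequentially comp_def, intro allI ballI impI, elim conjE)
  fix Y :: "nat \<Rightarrow> real" and y assume Y: "Y \<longlonglongrightarrow> y"
  have [measurable]: "g \<in> borel_measurable borel"
    using assms by simp
  show "(\<lambda>n. CLBINT t. iexp (- (t * Y n)) * g t) \<longlonglongrightarrow> (CLBINT t. iexp (- (t * y)) * g t)"
  proof (rule integral_dominated_convergence)
    show "integrable lborel (\<lambda>t. norm (g t))"
      using assms by simp
    show "AE t in lborel. (\<lambda>n. iexp (- (t * Y n)) * g t) \<longlonglongrightarrow> iexp (- (t * y)) * g t"
      by (intro AE_I2 tendsto_intros Y)
    show "AE t in lborel. norm (iexp (- (t * Y n)) * g t) \<le> norm (g t)" for n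
      by (simp add: norm_mult)
  qed simp_all
qed

text \<open>Levy's inversion formula is a limit of truncated integrals. Integrability of
  \<open>char M\<close> removes the truncation by dominated convergence; the kernel is then an
  integral over [a, b], and Fubini swaps the two integrations.\<close>

lemma (in real_distribution) measure_eq_integral_char:
  assumes "a \<le> b" and "measure M {a} = 0" "measure M {b} = 0" and int: "integrable lborel (char M)"
  shows "complex_of_real (measure M {a<..b}) =
    1 / (2 * pi) * (CLBINT y:{a..b}. (CLBINT t. iexp (- (t * y)) * char M t))"
proof -
  let ?F = "\<lambda>t. (iexp (- (t * a)) - iexp (- (t * b))) / (\<i> * t)"
  let ?h = "\<lambda>t y. indicator {a..b} y *\<^sub>R (iexp (- (t * y)) * char M t)"
  have [measurable]: "char M \<in> borel_measurable borel"
    using int by simp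
  \<comment> \<open>This supplies the majorant (b - a) |char M t|. At t = 0 the kernel is a division
    by zero, but that point is null.\<close>
  have bound: "norm (?F t) \<le> b - a" if "t \<noteq> 0" for t
    using Levy_Inversion_aux2[of "-b" "-a" t] that \<open>a \<le> b\<close> by simp
  have kernel: "(CLBINT y. ?h t y) = ?F t * char M t" if "t \<noteq> 0" for t
  proof -
    have "(CLBINT y. indicator {a..b} y *\<^sub>R iexp (- (t * y))) =
        iexp (- (t * b)) / (- \<i> * t) - iexp (- (t * a)) / (- \<i> * t)"
    proof (rule integral_FTC_Icc)
      show "((\<lambda>y. iexp (- (t * y)) / (- \<i> * t)) has_vector_derivative iexp (- (t * y))) (at y within {a..b})" for y
      proof -
        have "((\<lambda>w. exp (- (\<i> * t * w)) / (- \<i> * t)) has_field_derivative exp (- (\<i> * t * of_real y))) (at (of_real y))"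
          using that by (auto intro!: derivative_eq_intros)
        from has_vector_derivative_real_field[OF this] show ?thesis
          by (simp add: mult.assoc)
      qed
    qed (use \<open>a \<le> b\<close> in \<open>auto intro!: continuous_intros\<close>)
    also have "\<dots> = ?F t"
      using that by (simp add: field_simps)
    finally show ?thesis
      by (simp flip: mult_scaleR_left)
  qed
  have "(\<lambda>T. 1 / (2 * pi) * (CLBINT t=- real T..real T. ?F t * char M t))
      \<longlonglongrightarrow> complex_of_real (measure M {a<..b})"
    using Levy_Inversion[OF assms(1-3)] by simp
  moreover have "(\<lambda>T. CLBINT t=- real T..real T. ?F t * char M t) \<longlonglongrightarrow> (CLBINT t. ?F t * char M t)"
  proof -
    have "(\<lambda>T. CLBINT t. indicator {- real T<..<real T} t *\<^sub>R (?F t * char M t))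
        \<longlonglongrightarrow> (CLBINT t. ?F t * char M t)"
    proof (rule integral_dominated_convergence)
      show "integrable lborel (\<lambda>t. (b - a) * norm (char M t))"
        using int by simp
      show "AE t in lborel. (\<lambda>T. indicator {- real T<..<real T} t *\<^sub>R (?F t * char M t))
          \<longlonglongrightarrow> ?F t * char M t"
      proof (intro AE_I2 tendsto_eventually)
        fix t :: real
        obtain n :: nat where "\<bar>t\<bar> < real n"
          using reals_Archimedean2 by blast
        then show "\<forall>\<^sub>F T in sequentially. indicator {- real T<..<real T} t *\<^sub>R (?F t * char M t) = ?F t * char M t"
          by (intro eventually_sequentiallyI[of n]) (auto simp: indicator_def)
      qed
      show "AE t in lborel. norm (indicator {- real T<..<real T} t *\<^sub>R (?F t * char M t)) \<le> (b - a) * norm (char M t)" for T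
        using AE_lborel_singleton[of 0]
      proof eventually_elim
        fix t :: real assume "t \<noteq> 0"
        then have "norm (?F t * char M t) \<le> (b - a) * norm (char M t)"
          unfolding norm_mult by (intro mult_right_mono bound) auto
        then show "norm (indicator {- real T<..<real T} t *\<^sub>R (?F t * char M t)) \<le> (b - a) * norm (char M t)"
          using \<open>a \<le> b\<close> by (auto split: split_indicator)
      qed
    qed simp_all
    then show ?thesis
      by (simp add: interval_lebesgue_integral_def set_lebesgue_integral_def)
  qed
  then have "(\<lambda>T. 1 / (2 * pi) * (CLBINT t=- real T..real T. ?F t * char M t))
      \<longlonglongrightarrow> 1 / (2 * pi) * (CLBINT t. ?F t * char M t)"
    by (intro tendsto_intros)
  ultimately have "complex_of_real (measure M {a<..b}) = 1 / (2 * pi) * (CLBINT t. ?F t * char M t)"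
    by (rule LIMSEQ_unique)
  also have "(CLBINT t. ?F t * char M t) = (CLBINT t. CLBINT y. ?h t y)"
  proof (rule integral_cong_AE)
    show "AE t in lborel. ?F t * char M t = (CLBINT y. ?h t y)"
      using AE_lborel_singleton[of 0] by eventually_elim (simp only: kernel not_False_eq_True)
  qed simp_all
  also have "\<dots> = (CLBINT y. CLBINT t. ?h t y)"
  proof (rule lborel_pair.Fubini_integral[symmetric])
    show "integrable (lborel \<Otimes>\<^sub>M lborel) (\<lambda>(t, y). ?h t y)"
    proof (rule lborel_pair.Fubini_integrable)
      have "norm (?h t y) = indicator {a..b} y * norm (char M t)" for t y
        by (simp add: norm_mult)
      then have "(LBINT y. norm (?h t y)) = (LBINT y. indicator {a..b} y * norm (char M t))" for t
        by (simp only:)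
      then have "(LBINT y. norm (?h t y)) = (b - a) * norm (char M t)" for t
        using \<open>a \<le> b\<close> by simp
      then show "integrable lborel (\<lambda>t. LBINT y. norm ((\<lambda>(t, y). ?h t y) (t, y)))"
        using int by simp
      show "AE t in lborel. integrable lborel (\<lambda>y. (\<lambda>(t, y). ?h t y) (t, y))"
      proof (intro AE_I2, unfold prod.case)
        fix t
        have "set_integrable lborel {a..b} (\<lambda>y. iexp (- (t * y)) * char M t)"
          by (intro borel_integrable_atLeastAtMost') (intro continuous_intros)
        then show "integrable lborel (?h t)"
          by (simp add: set_integrable_def)
      qed
    qed simp
  qed
  also have "\<dots> = (CLBINT y:{a..b}. (CLBINT t. iexp (- (t * y)) * char M t))"
    unfolding set_lebesgue_integral_def by simp
  finally show ?thesis .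
qed

text \<open>\<open>\<phi>\<close> and its candidate \<open>\<psi>\<close> are continuous and have
  equal integrals over every [y, u]; differentiating at u = y makes them agree at y.\<close>

lemma char_inversion_density:
  fixes \<phi> :: "real \<Rightarrow> real"
  assumes "prob_space (density lborel \<phi>)" and cont: "continuous_on UNIV \<phi>" and nonneg: "\<And>y. 0 \<le> \<phi> y"
    and int: "integrable lborel (char (density lborel \<phi>))"
  shows "complex_of_real (\<phi> y) = 1 / (2 * pi) * (CLBINT t. iexp (- (t * y)) * char (density lborel \<phi>) t)"
proof -
  define M where "M = density lborel (\<lambda>y. ennreal (\<phi> y))"
  define \<psi> where "\<psi> = (\<lambda>y. 1 / (2 * pi) * (CLBINT t. iexp (- (t * y)) * char M t))"
  have [measurable]: "\<phi> \<in> borel_measurable borel"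
    by (rule borel_measurable_continuous_onI[OF cont])
  interpret M: prob_space M
    using assms(1) by (simp add: M_def)
  interpret M: real_distribution M
    by standard (simp_all add: M_def)
  have null: "measure M {a} = 0" for a
    by (simp add: M_def measure_def emeasure_density nn_integral_cmult_indicator)
  have cont\<psi>: "continuous_on UNIV \<psi>"
    unfolding \<psi>_def using int
    by (intro continuous_intros continuous_on_fourier_integral) (simp add: M_def)
  have eq: "integral {y..u} (\<lambda>x. complex_of_real (\<phi> x)) = integral {y..u} \<psi>" if "y \<le> u" for u
  proof -
    have "set_integrable lborel {y..u} \<phi>"
      by (intro borel_integrable_atLeastAtMost' continuous_on_subset[OF cont]) auto
    have "measure M {y<..u} = (LBINT x:{y..u}. \<phi> x)"
    proof -
      have "emeasure M {y<..u} = (\<integral>\<^sup>+x. ennreal (indicator {y..u} x * \<phi> x) \<partial>lborel)"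
        using AE_lborel_singleton[of y] unfolding M_def
        by (subst emeasure_density)
           (auto intro!: nn_integral_cong_AE elim!: eventually_mono simp: indicator_def)
      also have "\<dots> = ennreal (LBINT x:{y..u}. \<phi> x)"
        using \<open>set_integrable lborel {y..u} \<phi>\<close> nonneg
        unfolding set_lebesgue_integral_def set_integrable_def
        by (simp add: nn_integral_eq_integral)
      finally show ?thesis
        using nonneg by (simp add: measure_def set_lebesgue_integral_def integral_nonneg_AE)
    qed
    also have "complex_of_real (LBINT x:{y..u}. \<phi> x) = (CLBINT x:{y..u}. complex_of_real (\<phi> x))"
      by (rule set_integral_complex_of_real[symmetric])
    also have "\<dots> = integral {y..u} (\<lambda>x. complex_of_real (\<phi> x))"
      by (intro set_borel_integral_eq_integral(2) borel_integrable_atLeastAtMost' continuous_intros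
          continuous_on_subset[OF cont]) auto
    finally have "integral {y..u} (\<lambda>x. complex_of_real (\<phi> x)) = complex_of_real (measure M {y<..u})" ..
    also have "\<dots> = (CLBINT x:{y..u}. \<psi> x)"
      using M.measure_eq_integral_char[OF that null null] int
      by (simp add: M_def \<psi>_def)
    also have "\<dots> = integral {y..u} \<psi>"
      by (intro set_borel_integral_eq_integral(2) borel_integrable_atLeastAtMost'
          continuous_on_subset[OF cont\<psi>]) auto
    finally show ?thesis .
  qed
  have "complex_of_real (\<phi> y) = \<psi> y"
  \<comment> \<open>The integrals are compared only for u >= y, so the derivative is one-sided,
    taken within [y, y + 1].\<close>
  proof (rule vector_derivative_unique_within_closed_interval)
    show "y < y + 1" "y \<in> cbox y (y + 1)" by simp_all
    show "((\<lambda>u. integral {y..u} \<psi>) has_vector_derivative \<psi> y) (at y within cbox y (y + 1))"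
      unfolding cbox_interval
      by (intro integral_has_vector_derivative continuous_on_subset[OF cont\<psi>]) auto
    have "((\<lambda>u. integral {y..u} (\<lambda>x. complex_of_real (\<phi> x))) has_vector_derivative \<phi> y) (at y within {y..y + 1})"
      by (intro integral_has_vector_derivative continuous_intros continuous_on_subset[OF cont]) auto
    then show "((\<lambda>u. integral {y..u} \<psi>) has_vector_derivative \<phi> y) (at y within cbox y (y + 1))"
      unfolding cbox_interval
      by (rule has_vector_derivative_transform[rotated -1]) (auto simp: eq)
  qed
  then show ?thesis
    by (simp add: \<psi>_def M_def)
qed

text \<open>Reduction to a probability density by dividing by the total mass \<open>Z\<close>. Since
  \<open>Z\<close> is the characteristic function at 0, the nonvanishing hypothesis makes it
  positive.\<close>

lemma char_inversion_finite_density: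
  fixes \<phi> :: "real \<Rightarrow> real"
  assumes "finite_measure (density lborel \<phi>)" and cont: "continuous_on UNIV \<phi>" and nonneg: "\<And>y. 0 \<le> \<phi> y"
    and int: "integrable lborel (char (density lborel \<phi>))" and nz: "char (density lborel \<phi>) 0 \<noteq> 0"
  shows "complex_of_real (\<phi> y) = 1 / (2 * pi) * (CLBINT t. iexp (- (t * y)) * char (density lborel \<phi>) t)"
proof -
  define M where "M = density lborel (\<lambda>y. ennreal (\<phi> y))"
  define Z where "Z = measure M (space M)"
  have [measurable]: "\<phi> \<in> borel_measurable borel"
    by (rule borel_measurable_continuous_onI[OF cont])
  interpret M: finite_measure M
    using assms(1) by (simp add: M_def)
  have "char M 0 = of_real Z"
    by (simp add: char_def Z_def scaleR_conv_of_real)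
  with nz have "0 < Z"
    by (simp add: M_def[symmetric] Z_def zero_less_measure_iff)
  have scaled: "char (density lborel (\<lambda>y. ennreal (\<phi> y / Z))) t = char M t / Z" for t
    unfolding M_def using nonneg \<open>0 < Z\<close> by (simp add: char_density)
  have "complex_of_real (\<phi> y / Z) =
      1 / (2 * pi) * (CLBINT t. iexp (- (t * y)) * char (density lborel (\<lambda>y. ennreal (\<phi> y / Z))) t)"
  proof (rule char_inversion_density)
    have "(\<integral>\<^sup>+y. ennreal (\<phi> y / Z) \<partial>lborel) = ennreal (1 / Z) * emeasure M (space M)"
      using \<open>0 < Z\<close> nonneg
      by (simp add: M_def emeasure_density nn_integral_cmult[symmetric] flip: ennreal_mult)
    also have "\<dots> = 1"
      using \<open>0 < Z\<close> by (simp add: M.emeasure_eq_measure Z_def[symmetric] flip: ennreal_mult)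
    finally show "prob_space (density lborel (\<lambda>y. ennreal (\<phi> y / Z)))"
      by (intro prob_spaceI) (simp add: emeasure_density)
    show "continuous_on UNIV (\<lambda>y. \<phi> y / Z)"
      using \<open>0 < Z\<close> by (intro continuous_intros cont) simp
    show "integrable lborel (char (density lborel (\<lambda>y. ennreal (\<phi> y / Z))))"
      unfolding scaled[abs_def] using int by (simp add: M_def)
  qed (use nonneg \<open>0 < Z\<close> in simp)
  then show ?thesis
    using \<open>0 < Z\<close> unfolding scaled by (simp add: M_def field_simps)
qed

section \<open>Radial multiplicative convolution and nascent deltas\<close>

text \<open>Under \<open>x \<mapsto> \<Prod>j=1..m+1. x j\<close> the density \<open>\<Prod>j. f j (|x j|\<^sup>2)\<close> is pushed forward to
  \<open>radial_conv f m (|w|\<^sup>2)\<close>. Index \<open>m\<close> means \<open>m + 1\<close> factors, numbered from 1.\<close>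

primrec radial_conv :: "(nat \<Rightarrow> real \<Rightarrow> ennreal) \<Rightarrow> nat \<Rightarrow> real \<Rightarrow> ennreal" where
  "radial_conv f 0 r = f 1 r"
| "radial_conv f (Suc m) r =
    (\<integral>\<^sup>+x. f (Suc (Suc m)) ((norm (x::complex))\<^sup>2) * ennreal (1 / (norm x)\<^sup>2) *
       radial_conv f m (r / (norm x)\<^sup>2) \<partial>lborel)"

lemma borel_measurable_radial_conv [measurable]:
  assumes [measurable]: "\<And>j. f j \<in> borel_measurable borel"
  shows "radial_conv f m \<in> borel_measurable borel"
proof (induction m)
  case (Suc m)
  note [measurable] = Suc.IH
  show ?case by simp
qed simp

text \<open>Induction that splits off the last coordinate y and applies the hypothesis to the test
  function w -> h(y w), which is why \<open>h\<close> is arbitrary. Rescaling w by y and Tonelli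
  then produce the recursion.\<close>

lemma nn_integral_radial_conv:
  fixes h :: "complex \<Rightarrow> ennreal"
  assumes [measurable]: "\<And>j. f j \<in> borel_measurable borel" and "h \<in> borel_measurable borel"
  shows "(\<integral>\<^sup>+x. h (\<Prod>j=1..Suc m. x j) * (\<Prod>j=1..Suc m. f j ((norm (x j))\<^sup>2)) \<partial>PiM {1..Suc m} (\<lambda>_. lborel)) =
    (\<integral>\<^sup>+w. h w * radial_conv f m ((norm w)\<^sup>2) \<partial>lborel)"
  using assms(2)
proof (induction m arbitrary: h)
  case 0
  interpret product_sigma_finite "\<lambda>_::nat. lborel :: complex measure" by standard
  show ?case
    using 0 product_nn_integral_singleton[of "\<lambda>w. h w * f 1 ((norm w)\<^sup>2)" 1] by simp
next
  case (Suc m)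
  note [measurable] = Suc.prems
  interpret product_sigma_finite "\<lambda>_::nat. lborel :: complex measure" by standard
  let ?k = "Suc (Suc m)" and ?W = "radial_conv f m"
  have set: "{1..?k} = insert ?k {1..Suc m}" by auto
  have upd: "(\<Prod>j=1..Suc m. g j ((x(?k := y)) j)) = (\<Prod>j=1..Suc m. g j (x j))"
    for g :: "nat \<Rightarrow> complex \<Rightarrow> 'b::comm_monoid_mult" and x y
    by (rule prod.cong) auto
  \<comment> \<open>The weight 1/|y|^2 in \<open>radial_conv\<close> is the Jacobian of this
    rescaling; y = 0 is a null set.\<close>
  have inner: "(\<integral>\<^sup>+w. h (y * w) * ?W ((norm w)\<^sup>2) \<partial>lborel) =
      ennreal (1 / (norm y)\<^sup>2) * (\<integral>\<^sup>+w. h w * ?W ((norm w)\<^sup>2 / (norm y)\<^sup>2) \<partial>lborel)" if "y \<noteq> 0" for y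
  proof -
    have "(\<integral>\<^sup>+w. h w * ?W ((norm w)\<^sup>2 / (norm y)\<^sup>2) \<partial>lborel) =
        ennreal ((norm y)\<^sup>2) * (\<integral>\<^sup>+w. h (y * w) * ?W ((norm w)\<^sup>2) \<partial>lborel)"
      using that
      by (subst nn_integral_complex_affine[where a = y and b = 0])
         (simp_all add: norm_mult power_mult_distrib)
    then show ?thesis
      using that by (simp add: mult.assoc[symmetric] flip: ennreal_mult')
  qed
  have "(\<integral>\<^sup>+x. h (\<Prod>j=1..?k. x j) * (\<Prod>j=1..?k. f j ((norm (x j))\<^sup>2)) \<partial>PiM {1..?k} (\<lambda>_. lborel)) =
     (\<integral>\<^sup>+y. \<integral>\<^sup>+x. h ((\<Prod>j=1..Suc m. x j) * y) *
        ((\<Prod>j=1..Suc m. f j ((norm (x j))\<^sup>2)) * f ?k ((norm y)\<^sup>2)) \<partial>PiM {1..Suc m} (\<lambda>_. lborel) \<partial>lborel)"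
    unfolding set
    by (subst product_nn_integral_insert_rev)
       (use upd[of "\<lambda>_ w. w"] upd[of "\<lambda>j w. f j ((norm w)\<^sup>2)"] in
         \<open>simp_all add: mult_ac del: prod.cl_ivl_Suc\<close>)
  also have "\<dots> = (\<integral>\<^sup>+y. f ?k ((norm y)\<^sup>2) * (\<integral>\<^sup>+x. h (y * (\<Prod>j=1..Suc m. x j)) *
        (\<Prod>j=1..Suc m. f j ((norm (x j))\<^sup>2)) \<partial>PiM {1..Suc m} (\<lambda>_. lborel)) \<partial>lborel)"
    by (subst nn_integral_cmult[symmetric]) (simp_all add: mult_ac del: prod.cl_ivl_Suc)
  also have "\<dots> = (\<integral>\<^sup>+y. f ?k ((norm y)\<^sup>2) * (\<integral>\<^sup>+w. h (y * w) * ?W ((norm w)\<^sup>2) \<partial>lborel) \<partial>lborel)"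
    by (subst Suc.IH) simp_all
  also have "\<dots> = (\<integral>\<^sup>+y. f ?k ((norm (y::complex))\<^sup>2) * (ennreal (1 / (norm y)\<^sup>2) *
      (\<integral>\<^sup>+w. h w * ?W ((norm w)\<^sup>2 / (norm y)\<^sup>2) \<partial>lborel)) \<partial>lborel)"
    using AE_lborel_singleton[of 0]
    by (intro nn_integral_cong_AE) (auto elim!: eventually_mono simp: inner)
  also have "\<dots> = (\<integral>\<^sup>+y. \<integral>\<^sup>+w. h w * (f ?k ((norm (y::complex))\<^sup>2) * ennreal (1 / (norm y)\<^sup>2) *
      ?W ((norm w)\<^sup>2 / (norm y)\<^sup>2)) \<partial>lborel \<partial>lborel)"
    by (simp add: nn_integral_cmult[symmetric] mult_ac)
  also have "\<dots> = (\<integral>\<^sup>+w. \<integral>\<^sup>+y. h w * (f ?k ((norm (y::complex))\<^sup>2) * ennreal (1 / (norm y)\<^sup>2) *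
      ?W ((norm w)\<^sup>2 / (norm y)\<^sup>2)) \<partial>lborel \<partial>lborel)"
    by (rule lborel_pair.Fubini') simp
  finally show ?case by (simp add: nn_integral_cmult)
qed

section \<open>Monotonicity, scaling and limits of the convolution\<close>

lemma radial_conv_antimono:
  assumes "\<And>r r'. 0 \<le> r \<Longrightarrow> r \<le> r' \<Longrightarrow> f 1 r' \<le> f 1 r" and "0 \<le> r" "r \<le> r'"
  shows "radial_conv f m r' \<le> radial_conv f m r"
  using assms(2-)
proof (induction m arbitrary: r r')
  case (Suc m)
  then show ?case
    \<comment> \<open>In the recursion \<open>r\<close> occurs only in the argument of the previous
      convolution, so the inequality passes through the nonnegative kernel.\<close>
    by (auto intro!: nn_integral_mono mult_left_mono Suc.IH divide_right_mono)
qed (use assms(1) in simp)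

text \<open>Scaling \<open>r\<close> by \<open>l\<close> also scales the inner argument r/|x|^2 by
  \<open>l\<close>, so the constant \<open>C\<close> is simply carried along the induction.\<close>

lemma radial_conv_scaling:
  assumes [measurable]: "\<And>j. f j \<in> borel_measurable borel"
    and "\<And>r. 0 \<le> r \<Longrightarrow> f 1 r \<le> C * f 1 (l * r)" and "0 \<le> r"
  shows "radial_conv f m r \<le> C * radial_conv f m (l * r)"
  using assms(3)
proof (induction m arbitrary: r)
  case (Suc m)
  have "radial_conv f (Suc m) r \<le>
      (\<integral>\<^sup>+x. C * (f (Suc (Suc m)) ((norm (x::complex))\<^sup>2) * ennreal (1 / (norm x)\<^sup>2) *
        radial_conv f m (l * r / (norm x)\<^sup>2)) \<partial>lborel)"
    unfolding radial_conv.simps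
  proof (rule nn_integral_mono)
    fix x :: complex
    have "radial_conv f m (r / (norm x)\<^sup>2) \<le> C * radial_conv f m (l * r / (norm x)\<^sup>2)"
      using Suc.IH[of "r / (norm x)\<^sup>2"] Suc.prems by simp
    from mult_left_mono[OF this, of "f (Suc (Suc m)) ((norm x)\<^sup>2) * ennreal (1 / (norm x)\<^sup>2)"]
    show "f (Suc (Suc m)) ((norm x)\<^sup>2) * ennreal (1 / (norm x)\<^sup>2) * radial_conv f m (r / (norm x)\<^sup>2) \<le>
        C * (f (Suc (Suc m)) ((norm x)\<^sup>2) * ennreal (1 / (norm x)\<^sup>2) *
          radial_conv f m (l * r / (norm x)\<^sup>2))"
      by (simp add: mult_ac)
  qed
  also have "\<dots> = C * radial_conv f (Suc m) (l * r)"
    by (simp add: nn_integral_cmult)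
  finally show ?case .
qed (use assms(2) in simp)

text \<open>Sandwich between W a times min(1, a/r)^p and W a times max(1, a/r)^p. On each side of a,
  one bound is monotonicity and the other is scaling by the ratio of the two points.\<close>

lemma tendsto_of_antimono_scaling:
  fixes W :: "real \<Rightarrow> ennreal"
  assumes anti: "\<And>r r'. 0 < r \<Longrightarrow> r \<le> r' \<Longrightarrow> W r' \<le> W r"
    and scaling: "\<And>l r. 1 \<le> l \<Longrightarrow> 0 < r \<Longrightarrow> W r \<le> ennreal (l ^ p) * W (l * r)"
    and "0 < a"
  shows "(W \<longlongrightarrow> W a) (at a)"
proof (rule tendsto_sandwich)
  have pos: "\<forall>\<^sub>F r::real in at a. 0 < r"
    using \<open>0 < a\<close> by (intro order_tendstoD(1)[OF tendsto_ident_at])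
  show "\<forall>\<^sub>F r::real in at a. W r \<le> ennreal (max 1 (a / r) ^ p) * W a"
    using pos
  proof eventually_elim
    fix r :: real assume "0 < r"
    show "W r \<le> ennreal (max 1 (a / r) ^ p) * W a"
    proof (cases "a \<le> r")
      case True
      then show ?thesis
        using anti[OF \<open>0 < a\<close> True] \<open>0 < r\<close> by (simp add: max_def divide_simps)
    next
      case False
      then show ?thesis
        using scaling[of "a / r" r] \<open>0 < r\<close> by (simp add: max_def)
    qed
  qed
  show "\<forall>\<^sub>F r::real in at a. ennreal (min 1 (a / r) ^ p) * W a \<le> W r"
    using pos
  proof eventually_elim
    fix r :: real assume "0 < r"
    show "ennreal (min 1 (a / r) ^ p) * W a \<le> W r"
    proof (cases "a \<le> r")
      case True
      \<comment> \<open>Scaling from a to r = (r/a) a bounds W a by (r/a)^p W r; multiplying by the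
        inverse power isolates W r.\<close>
      then have "ennreal ((a / r) ^ p) * W a \<le> ennreal ((a / r) ^ p) * (ennreal ((r / a) ^ p) * W r)"
        using scaling[of "r / a" a] \<open>0 < a\<close> \<open>0 < r\<close> by (intro mult_left_mono) simp_all
      also have "\<dots> = W r"
        using \<open>0 < a\<close> \<open>0 < r\<close>
        by (simp add: mult.assoc[symmetric] power_mult_distrib[symmetric] flip: ennreal_mult)
      finally show ?thesis
        using True \<open>0 < r\<close> by (simp add: min_def divide_simps split: if_splits)
    next
      case False
      then show ?thesis
        using anti[of r a] \<open>0 < r\<close> by (simp add: min_def divide_simps split: if_splits)
    qed
  qed
  \<comment> \<open>The prefactor tends to 1, so no product of 0 and infinity arises even if W a is
    infinite.\<close>
  have "((\<lambda>r::real. ennreal (max 1 (a / r) ^ p) * W a) \<longlongrightarrow> ennreal (max 1 (a / a) ^ p) * W a) (at a)"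
    using \<open>0 < a\<close> by (intro tendsto_mult_ennreal tendsto_ennrealI tendsto_intros) auto
  then show "((\<lambda>r::real. ennreal (max 1 (a / r) ^ p) * W a) \<longlongrightarrow> W a) (at a)"
    using \<open>0 < a\<close> by simp
  have "((\<lambda>r::real. ennreal (min 1 (a / r) ^ p) * W a) \<longlongrightarrow> ennreal (min 1 (a / a) ^ p) * W a) (at a)"
    using \<open>0 < a\<close> by (intro tendsto_mult_ennreal tendsto_ennrealI tendsto_intros) auto
  then show "((\<lambda>r::real. ennreal (min 1 (a / r) ^ p) * W a) \<longlongrightarrow> W a) (at a)"
    using \<open>0 < a\<close> by simp
qed

text \<open>A decreasing function increases to its supremum as r falls to 0; in
  \<open>ennreal\<close> this supremum always exists and may be infinite.\<close>

lemma tendsto_at_right_SUP_antimono: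
  fixes W :: "real \<Rightarrow> ennreal"
  assumes "\<And>r r'. 0 < r \<Longrightarrow> r \<le> r' \<Longrightarrow> W r' \<le> W r"
  shows "(W \<longlongrightarrow> (SUP r\<in>{0<..}. W r)) (at_right 0)"
proof (rule order_tendstoI)
  fix l assume "l < (SUP r\<in>{0<..}. W r)"
  then obtain r where "0 < r" "l < W r"
    by (auto simp: less_SUP_iff)
  then have "l < W x" if "0 < x" "x < r" for x
    using assms[of x r] that by (auto intro: less_le_trans)
  then show "\<forall>\<^sub>F x in at_right 0. l < W x"
    using \<open>0 < r\<close> by (auto simp: eventually_at_right_field)
next
  fix u assume u: "(SUP r\<in>{0<..}. W r) < u"
  have "W x < u" if "0 < x" for x
    using that by (intro le_less_trans[OF SUP_upper u]) auto
  then show "\<forall>\<^sub>F x in at_right 0. W x < u"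
    by (auto simp: eventually_at_right_field intro: exI[of _ 1])
qed

text \<open>The kernel has mass 1 and support shrinking to z, so the integral averages F near z. The
  punctured limit suffices because {z} is null, and the order argument covers an infinite L.\<close>

lemma nn_integral_mollifier_tendsto:
  fixes F :: "complex \<Rightarrow> ennreal"
  assumes [measurable]: "F \<in> borel_measurable borel" and "mollifier \<eta>" and lim: "(F \<longlongrightarrow> L) (at z)"
  shows "((\<lambda>\<epsilon>. \<integral>\<^sup>+w. ennreal (\<eta> ((z - w) / complex_of_real \<epsilon>) / \<epsilon>\<^sup>2) * F w \<partial>lborel) \<longlongrightarrow> L) (at_right 0)"
proof -
  define k where "k = (\<lambda>\<epsilon> w. ennreal (\<eta> ((z - w) / complex_of_real \<epsilon>) / \<epsilon>\<^sup>2))"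
  from \<open>mollifier \<eta>\<close> obtain R where R: "\<And>w. R < norm w \<Longrightarrow> \<eta> w = 0"
    and cont: "continuous_on UNIV \<eta>" and nonneg: "\<And>w. 0 \<le> \<eta> w"
    and mass: "(\<integral>\<^sup>+w. ennreal (\<eta> w) \<partial>lborel) = 1"
    by (auto simp: mollifier_def)
  have [measurable]: "\<eta> \<in> borel_measurable borel"
    by (rule borel_measurable_continuous_onI[OF cont])
  have [measurable]: "k \<epsilon> \<in> borel_measurable borel" for \<epsilon>
    unfolding k_def by measurable
  have k_mass: "(\<integral>\<^sup>+w. c * k \<epsilon> w \<partial>lborel) = c" if "0 < \<epsilon>" for \<epsilon> c
  proof -
    \<comment> \<open>The substitution w -> z - \<epsilon> w has Jacobian \<epsilon>^2, which
      cancels the normalisation of the nascent delta.\<close>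
    have "(\<integral>\<^sup>+w. k \<epsilon> w \<partial>lborel) = ennreal (\<epsilon>\<^sup>2) * (\<integral>\<^sup>+w. k \<epsilon> (complex_of_real (- \<epsilon>) * w + z) \<partial>lborel)"
      using that by (subst nn_integral_complex_affine[where a = "complex_of_real (- \<epsilon>)" and b = z]) simp_all
    also have "\<dots> = (\<integral>\<^sup>+w. ennreal (\<eta> w) \<partial>lborel)"
      using that nonneg
      by (subst nn_integral_cmult[symmetric]) (simp_all add: k_def flip: ennreal_mult)
    finally show ?thesis
      by (simp add: nn_integral_cmult mass)
  qed
  have small: "\<forall>\<^sub>F \<epsilon> in at_right 0. 0 < \<epsilon> \<and> (\<forall>w. w \<noteq> z \<longrightarrow> k \<epsilon> w \<noteq> 0 \<longrightarrow> P w)"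
    if P: "\<forall>\<^sub>F w in at z. P w" for P
  proof -
    from P obtain d where d: "0 < d" "\<And>w. w \<noteq> z \<Longrightarrow> dist w z < d \<Longrightarrow> P w"
      by (auto simp: eventually_at)
    \<comment> \<open>The bound R may be zero or negative; |R| + 1 is a positive
      replacement.\<close>
    have "P w" if "0 < \<epsilon>" "\<epsilon> < d / (\<bar>R\<bar> + 1)" "w \<noteq> z" "k \<epsilon> w \<noteq> 0" for \<epsilon> w
    proof (rule d(2)[OF \<open>w \<noteq> z\<close>])
      have "\<eta> ((z - w) / complex_of_real \<epsilon>) \<noteq> 0"
        using that by (auto simp: k_def)
      then have "norm ((z - w) / complex_of_real \<epsilon>) \<le> R"
        using R by force
      then have "dist w z \<le> R * \<epsilon>"
        using \<open>0 < \<epsilon>\<close> by (simp add: norm_divide divide_simps dist_norm norm_minus_commute)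
      also have "\<dots> \<le> (\<bar>R\<bar> + 1) * \<epsilon>"
        using \<open>0 < \<epsilon>\<close> by (intro mult_right_mono) auto
      also have "\<dots> < d"
        using that by (simp add: field_simps)
      finally show "dist w z < d" .
    qed
    then show ?thesis
      unfolding eventually_at_right_field
      using \<open>0 < d\<close> by (intro exI[of _ "d / (\<bar>R\<bar> + 1)"]) auto
  qed
  have "((\<lambda>\<epsilon>. \<integral>\<^sup>+w. k \<epsilon> w * F w \<partial>lborel) \<longlongrightarrow> L) (at_right 0)"
  proof (rule order_tendstoI)
    fix l assume "l < L"
    \<comment> \<open>Averaging preserves only non-strict inequalities, hence the intermediate value
      strictly between l and L.\<close>
    then obtain l' where l': "l < l'" "l' < L"
      using dense by blast
    from small[OF order_tendstoD(1)[OF lim \<open>l' < L\<close>]]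
    show "\<forall>\<^sub>F \<epsilon> in at_right 0. l < (\<integral>\<^sup>+w. k \<epsilon> w * F w \<partial>lborel)"
    proof eventually_elim
      case (elim \<epsilon>)
      have "l' = (\<integral>\<^sup>+w. l' * k \<epsilon> w \<partial>lborel)"
        using elim by (simp add: k_mass)
      also have "\<dots> \<le> (\<integral>\<^sup>+w. k \<epsilon> w * F w \<partial>lborel)"
      proof (rule nn_integral_mono_AE, use AE_lborel_singleton[of z] in eventually_elim)
        fix w assume "w \<noteq> z"
        with elim have "k \<epsilon> w = 0 \<or> l' \<le> F w" by (auto intro: less_imp_le)
        then show "l' * k \<epsilon> w \<le> k \<epsilon> w * F w"
          by (auto simp: mult.commute[of l'] intro: mult_left_mono)
      qed
      finally show ?case using l' by simp
    qed
  next
    fix u assume "L < u"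
    then obtain u' where u': "L < u'" "u' < u"
      using dense by blast
    from small[OF order_tendstoD(2)[OF lim \<open>L < u'\<close>]]
    show "\<forall>\<^sub>F \<epsilon> in at_right 0. (\<integral>\<^sup>+w. k \<epsilon> w * F w \<partial>lborel) < u"
    proof eventually_elim
      case (elim \<epsilon>)
      have "(\<integral>\<^sup>+w. k \<epsilon> w * F w \<partial>lborel) \<le> (\<integral>\<^sup>+w. u' * k \<epsilon> w \<partial>lborel)"
      proof (rule nn_integral_mono_AE, use AE_lborel_singleton[of z] in eventually_elim)
        fix w assume "w \<noteq> z"
        with elim have "k \<epsilon> w = 0 \<or> F w \<le> u'" by (auto intro: less_imp_le)
        then show "k \<epsilon> w * F w \<le> u' * k \<epsilon> w"
          by (auto simp: mult.commute[of u'] intro: mult_left_mono)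
      qed
      also have "\<dots> = u'"
        using elim by (simp add: k_mass)
      finally show ?case using u' by simp
    qed
  qed
  then show ?thesis
    by (simp add: k_def)
qed

section \<open>Mellin transform of a radial convolution\<close>

lemma density_cmult_measure:
  fixes g :: "real \<Rightarrow> ennreal"
  assumes [measurable]: "g \<in> borel_measurable borel" and "finite_measure (density lborel g)" and "0 \<le> C"
  shows "finite_measure (density lborel (\<lambda>u. ennreal C * g u))"
    and "char (density lborel (\<lambda>u. ennreal C * g u)) t = of_real C * char (density lborel g) t"
proof -
  interpret finite_measure "density lborel g" by fact
  have eq: "density lborel (\<lambda>u. ennreal C * g u) = density (density lborel g) (\<lambda>_. ennreal C)"
    by (subst density_density_eq) (simp_all add: mult.commute)
  show "finite_measure (density lborel (\<lambda>u. ennreal C * g u))"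
    unfolding eq using emeasure_finite[of UNIV]
    by (intro finite_measureI) (simp add: emeasure_density[of _ "density lborel g"] ennreal_mult_eq_top_iff)
  show "char (density lborel (\<lambda>u. ennreal C * g u)) t = of_real C * char (density lborel g) t"
    unfolding eq char_def using \<open>0 \<le> C\<close>
    by (subst integral_density) (simp_all add: scaleR_conv_of_real)
qed

text \<open>With u = ln |x|^2, the measure d^2x/|x|^2 becomes pi du, and r/|x|^2 becomes exp(y - u).
  The factor exp(c y) splits accordingly, leaving an additive convolution.\<close>

lemma radial_conv_Suc_exp:
  assumes [measurable]: "\<And>j. f j \<in> borel_measurable borel"
  shows "ennreal (exp (c * y)) * radial_conv f (Suc m) (exp y) =
    (\<integral>\<^sup>+u. ennreal (exp (c * (y - u))) * radial_conv f m (exp (y - u)) *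
       (ennreal pi * (ennreal (exp (c * u)) * f (Suc (Suc m)) (exp u))) \<partial>lborel)"
proof -
  let ?H = "\<lambda>u. f (Suc (Suc m)) (exp u) * ennreal (1 / exp u) * radial_conv f m (exp y / exp u)"
  have "radial_conv f (Suc m) (exp y) = (\<integral>\<^sup>+x. ?H (2 * ln (norm (x::complex))) \<partial>lborel)"
    unfolding radial_conv.simps
  proof (rule nn_integral_cong_AE, use AE_lborel_singleton[of 0] in eventually_elim)
    fix x :: complex assume "x \<noteq> 0"
    then have "exp (2 * ln (norm x)) = (norm x)\<^sup>2"
      by (simp add: exp_double)
    then show "f (Suc (Suc m)) ((norm x)\<^sup>2) * ennreal (1 / (norm x)\<^sup>2) * radial_conv f m (exp y / (norm x)\<^sup>2) =
        ?H (2 * ln (norm x))"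
      by simp
  qed
  also have "\<dots> = (\<integral>\<^sup>+u. ennreal (pi * exp u) * ?H u \<partial>lborel)"
    by (rule nn_integral_radial) simp
  finally have "ennreal (exp (c * y)) * radial_conv f (Suc m) (exp y) =
      (\<integral>\<^sup>+u. ennreal (exp (c * y)) * (ennreal (pi * exp u) * ?H u) \<partial>lborel)"
    by (simp add: nn_integral_cmult)
  also have "\<dots> = (\<integral>\<^sup>+u. ennreal (exp (c * (y - u))) * radial_conv f m (exp (y - u)) *
       (ennreal pi * (ennreal (exp (c * u)) * f (Suc (Suc m)) (exp u))) \<partial>lborel)"
  proof (rule nn_integral_cong)
    fix u
    have "ennreal (exp (c * y)) * (ennreal (pi * exp u) * ?H u) =
        (ennreal (exp (c * y)) * ennreal (pi * exp u) * ennreal (1 / exp u)) *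
        (f (Suc (Suc m)) (exp u) * radial_conv f m (exp (y - u)))"
      by (simp add: mult_ac exp_diff)
    also have "ennreal (exp (c * y)) * ennreal (pi * exp u) * ennreal (1 / exp u) =
        ennreal (exp (c * (y - u))) * ennreal pi * ennreal (exp (c * u))"
      by (simp add: exp_diff right_diff_distrib flip: ennreal_mult)
    finally show "ennreal (exp (c * y)) * (ennreal (pi * exp u) * ?H u) =
       ennreal (exp (c * (y - u))) * radial_conv f m (exp (y - u)) *
       (ennreal pi * (ennreal (exp (c * u)) * f (Suc (Suc m)) (exp u)))"
      by (simp add: mult_ac)
  qed
  finally show ?thesis .
qed

text \<open>Each of the m convolutions contributes one factor pi. Finiteness is carried through the
  same induction because the convolution rules require it.\<close>

lemma radial_conv_char:
  assumes [measurable]: "\<And>j. f j \<in> borel_measurable borel"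
    and fin: "\<And>j. finite_measure (density lborel (\<lambda>u. ennreal (exp (c * u)) * f j (exp u)))"
  shows "finite_measure (density lborel (\<lambda>y. ennreal (exp (c * y)) * radial_conv f m (exp y))) \<and>
    char (density lborel (\<lambda>y. ennreal (exp (c * y)) * radial_conv f m (exp y))) t =
      of_real (pi ^ m) * (\<Prod>j=1..Suc m. char (density lborel (\<lambda>u. ennreal (exp (c * u)) * f j (exp u))) t)"
proof (induction m)
  case 0
  then show ?case using fin by simp
next
  case (Suc m)
  let ?M = "density lborel (\<lambda>y. ennreal (exp (c * y)) * radial_conv f m (exp y))"
  let ?g = "\<lambda>u. ennreal (exp (c * u)) * f (Suc (Suc m)) (exp u)"
  let ?N = "density lborel (\<lambda>u. ennreal pi * ?g u)"
  have N: "finite_measure ?N" "char ?N t = of_real pi * char (density lborel ?g) t"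
    by (rule density_cmult_measure; use fin in simp)+
  have "?M \<star> ?N = density lborel (\<lambda>y. ennreal (exp (c * y)) * radial_conv f (Suc m) (exp y))"
    unfolding radial_conv_Suc_exp[OF assms(1)] using Suc.IH N
    by (intro convolution_density) simp_all
  moreover have "finite_measure (?M \<star> ?N)"
    using Suc.IH N by (intro convolution_finite) simp_all
  moreover have "char (?M \<star> ?N) t = char ?M t * char ?N t"
    using Suc.IH N by (intro char_convolution) simp_all
  ultimately show ?case
    using Suc.IH N by (simp add: mult_ac)
qed

text \<open>An infinite value at r would by monotonicity persist on the half-line y <= ln r,
  contradicting the finite total mass.\<close>

lemma radial_conv_finite:
  assumes [measurable]: "\<And>j. f j \<in> borel_measurable borel"
    and anti: "\<And>r r'. 0 \<le> r \<Longrightarrow> r \<le> r' \<Longrightarrow> f 1 r' \<le> f 1 r"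
    and fin: "finite_measure (density lborel (\<lambda>y. ennreal (exp (c * y)) * radial_conv f m (exp y)))"
    and "0 < r"
  shows "radial_conv f m r < \<infinity>"
proof (rule ccontr)
  assume "\<not> radial_conv f m r < \<infinity>"
  then have inf: "radial_conv f m r = \<infinity>"
    by (simp flip: less_top)
  have top: "ennreal (exp (c * y)) * radial_conv f m (exp y) = \<infinity>" if "y \<le> ln r" for y
  proof -
    have "exp y \<le> r"
      using that \<open>0 < r\<close> by (metis exp_le_cancel_iff exp_ln)
    then have "radial_conv f m r \<le> radial_conv f m (exp y)"
      by (intro radial_conv_antimono anti) auto
    then show ?thesis
      using inf by (simp add: top_unique ennreal_mult_eq_top_iff)
  qed
  have "(\<integral>\<^sup>+y. ennreal (exp (c * y)) * radial_conv f m (exp y) \<partial>lborel) \<noteq> \<infinity>"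
    using finite_measure.emeasure_finite[OF fin, of UNIV] by (simp add: emeasure_density)
  then have "AE y in lborel. ennreal (exp (c * y)) * radial_conv f m (exp y) \<noteq> \<infinity>"
    by (intro nn_integral_PInf_AE) simp_all
  then have "AE y in lborel. y \<notin> {..ln r}"
    by eventually_elim (use top in auto)
  then have "emeasure lborel {..ln r} = 0"
    by (subst (asm) AE_iff_measurable[where N = "{..ln r}"]) auto
  moreover have "emeasure lborel {ln r - 1..ln r} \<le> emeasure lborel {..ln r}"
    by (intro emeasure_mono) auto
  ultimately show False
    by simp
qed

section \<open>The Cauchy-Lorentz factors\<close>

text \<open>The argument stands for |x|^2, so that one factor of the weight integrand becomes a
  function on the half-line.\<close>

definition cauchy_factor :: "nat \<Rightarrow> nat \<Rightarrow> real \<Rightarrow> real" where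
  "cauchy_factor N k r = r ^ k / (1 + r) ^ (k + N + 1)"

lemma borel_measurable_cauchy_factor [measurable]: "cauchy_factor N k \<in> borel_measurable borel"
  unfolding cauchy_factor_def by measurable

lemma cauchy_factor_nonneg: "0 \<le> r \<Longrightarrow> 0 \<le> cauchy_factor N k r"
  by (simp add: cauchy_factor_def)

lemma cauchy_factor_0_antimono: "0 \<le> r \<Longrightarrow> r \<le> r' \<Longrightarrow> cauchy_factor N 0 r' \<le> cauchy_factor N 0 r"
  unfolding cauchy_factor_def by (auto intro!: divide_left_mono power_mono mult_pos_pos simp del: power_Suc)

text \<open>For l >= 1 one has 1 + l r <= l (1 + r).\<close>

lemma cauchy_factor_0_scaling:
  assumes "1 \<le> l" "0 \<le> r"
  shows "cauchy_factor N 0 r \<le> l ^ (N + 1) * cauchy_factor N 0 (l * r)"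
proof -
  have "(1 + l * r) ^ (N + 1) \<le> (l * (1 + r)) ^ (N + 1)"
    using assms by (intro power_mono) (simp_all add: algebra_simps)
  moreover have "0 < 1 + r" "0 < 1 + l * r"
    using assms by (auto intro: add_pos_nonneg)
  ultimately show ?thesis
    by (simp add: cauchy_factor_def divide_simps power_mult_distrib mult_ac del: power_Suc)
qed

text \<open>The log-Beta density with parameters k + c and N + 1 - c. The strip 0 < c < N + 1 keeps
  both positive, and their sum k + N + 1 is free of c.\<close>

lemma cauchy_factor_char:
  fixes c :: real and k N :: nat
  assumes "0 < c" "c < real N + 1"
  defines "D \<equiv> density lborel (\<lambda>u. ennreal (exp (c * u)) * ennreal (cauchy_factor N k (exp u)))"
  shows "finite_measure D"
    and "char D t = Gamma (Complex (k + c) t) * Gamma (Complex (real N + 1 - c) (- t)) / of_real (Gamma (real k + real N + 1))"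
proof -
  have "exp (c * u) * cauchy_factor N k (exp u) = exp ((k + c) * u) / (1 + exp u) powr (k + c + (real N + 1 - c))" for u
  proof -
    have "(1 + exp u) powr (k + c + (real N + 1 - c)) = (1 + exp u) ^ (k + N + 1)"
      by (subst powr_realpow[symmetric]) (simp_all add: add_pos_pos add_ac)
    then show ?thesis
      by (simp add: cauchy_factor_def exp_of_nat_mult[symmetric] distrib_right exp_add)
  qed
  then have D: "D = density lborel (\<lambda>u. ennreal (exp ((k + c) * u) / (1 + exp u) powr (k + c + (real N + 1 - c))))"
    unfolding D_def by (simp add: cauchy_factor_nonneg flip: ennreal_mult)
  have "0 < k + c" "0 < real N + 1 - c" using assms by auto
  note * = log_Beta_density[OF this, folded D]
  show "finite_measure D" by (rule *)
  show "char D t = Gamma (Complex (k + c) t) * Gamma (Complex (real N + 1 - c) (- t)) / of_real (Gamma (real k + real N + 1))"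
    using *(2)[of t] by (simp add: add_ac)
qed

section \<open>Decay of the Gamma factors along vertical lines\<close>

lemma integrable_inverse_sum_squares:
  assumes "0 < (c::real)"
  shows "integrable lborel (\<lambda>t. 1 / (c\<^sup>2 + t\<^sup>2))"
proof (rule Bochner_Integration.integrable_bound)
  \<comment> \<open>The constant K is chosen with K >= 1 and K c^2 >= 1, which gives 1 + t^2 <= K
    (c^2 + t^2).\<close>
  show "integrable lborel (\<lambda>t::real. max 1 (1 / c\<^sup>2) * inverse (1 + t\<^sup>2))"
    using integrable_inverse_1_plus_square by (simp add: set_integrable_def)
  show "AE t in lborel. norm (1 / (c\<^sup>2 + t\<^sup>2)) \<le> norm (max 1 (1 / c\<^sup>2) * inverse (1 + t\<^sup>2))"
  proof (intro AE_I2)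
    fix t :: real
    let ?K = "max 1 (1 / c\<^sup>2)"
    have "1 = 1 / c\<^sup>2 * c\<^sup>2" "t\<^sup>2 = 1 * t\<^sup>2"
      using assms by simp_all
    moreover have "1 / c\<^sup>2 * c\<^sup>2 \<le> ?K * c\<^sup>2" "1 * t\<^sup>2 \<le> ?K * t\<^sup>2"
      by (intro mult_right_mono; simp)+
    ultimately have "1 + t\<^sup>2 \<le> ?K * (c\<^sup>2 + t\<^sup>2)"
      unfolding distrib_left by linarith
    moreover have "0 < c\<^sup>2 + t\<^sup>2" "0 < 1 + t\<^sup>2"
      using assms by (auto intro: add_pos_nonneg)
    ultimately have "1 / (c\<^sup>2 + t\<^sup>2) \<le> ?K * inverse (1 + t\<^sup>2)"
      by (simp add: pos_divide_le_eq pos_le_divide_eq inverse_eq_divide)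
    then show "norm (1 / (c\<^sup>2 + t\<^sup>2)) \<le> norm (max 1 (1 / c\<^sup>2) * inverse (1 + t\<^sup>2))"
      by simp
  qed
qed simp

text \<open>Two steps of the functional equation of \<open>Gamma\<close> trade a bound on the line \<open>Re s = c + 2\<close> for
  quadratic decay on the line \<open>Re s = c\<close>.\<close>

lemma norm_Gamma_Complex_decay:
  assumes "0 < c"
  shows "norm (Gamma (Complex c t)) \<le> Gamma (c + 2) * (1 / (c\<^sup>2 + t\<^sup>2))"
proof -
  let ?s = "Complex c t"
  have nz: "?s \<noteq> 0" "?s + 1 \<noteq> 0"
    using assms by (auto simp: complex_eq_iff)
  have "Gamma (?s + 1 + 1) = (?s + 1) * (?s * Gamma ?s)"
    by (subst Gamma_plus1, use assms in \<open>auto simp: complex_eq_iff elim!: nonpos_Ints_cases\<close>)+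
  moreover have "?s + 1 + 1 = Complex (c + 2) t"
    by (simp add: complex_eq_iff)
  ultimately have "norm (?s + 1) * norm ?s * norm (Gamma ?s) \<le> Gamma (c + 2)"
    using norm_Gamma_Complex_le[of "c + 2" t] assms by (simp add: norm_mult)
  \<comment> \<open>Since Re s > 0, adding 1 increases the modulus, so both linear factors are at
    least |s|.\<close>
  moreover have "c\<^sup>2 + t\<^sup>2 \<le> norm (?s + 1) * norm ?s"
  proof -
    have "norm ?s \<le> norm (?s + 1)"
      using assms by (simp add: cmod_def power2_eq_square algebra_simps)
    then have "norm ?s * norm ?s \<le> norm (?s + 1) * norm ?s"
      by (intro mult_right_mono) auto
    moreover have "norm ?s * norm ?s = c\<^sup>2 + t\<^sup>2"
      by (simp add: cmod_power2 flip: power2_eq_square)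
    ultimately show ?thesis by simp
  qed
  ultimately have "(c\<^sup>2 + t\<^sup>2) * norm (Gamma ?s) \<le> Gamma (c + 2)"
    by (meson mult_right_mono norm_ge_zero order_trans)
  moreover have "0 < c\<^sup>2 + t\<^sup>2"
    using assms by (simp add: add_pos_nonneg)
  ultimately show ?thesis
    by (simp add: field_simps)
qed

section \<open>The Mellin-Barnes integral as an inverse Fourier transform\<close>

lemma meijer_G_exp:
  "meijer_G n (\<lambda>j. - of_nat N) (\<lambda>j. of_nat (\<nu> j)) c (exp y) =
    1 / (2 * pi) * of_real (exp (- c * y)) * (CLBINT t. iexp (- (t * y)) *
      (\<Prod>j=1..n. Gamma (Complex (\<nu> j + c) t) * Gamma (Complex (real N + 1 - c) (- t))))"
proof -
  let ?P = "\<lambda>t. \<Prod>j=1..n. Gamma (Complex (\<nu> j + c) t) * Gamma (Complex (real N + 1 - c) (- t))"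
  \<comment> \<open>At x = exp y the power x^(-s) separates into exp(-c y) and a Fourier kernel. The
    factor i from ds cancels the one in 1/(2 pi i).\<close>
  have *: "(let s = Complex c t in (\<Prod>j=1..n. Gamma (of_nat (\<nu> j) + s) * Gamma (1 - (- of_nat N) - s)) *
      of_real (exp y) powr (- s) * \<i>) =
      (of_real (exp (- c * y)) * \<i>) * (iexp (- (t * y)) * ?P t)" for t
  proof -
    have "of_nat (\<nu> j) + Complex c t = Complex (\<nu> j + c) t" for j
      by (simp add: complex_eq_iff)
    moreover have "1 - (- of_nat N) - Complex c t = Complex (real N + 1 - c) (- t)"
      by (simp add: complex_eq_iff)
    moreover have "complex_of_real (exp y) powr (- Complex c t) = of_real (exp (- c * y)) * iexp (- (t * y))"
      by (simp add: powr_def Ln_of_real Complex_eq algebra_simps flip: exp_of_real exp_add)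
    ultimately show ?thesis
      by (simp only: Let_def mult_ac)
  qed
  show ?thesis
    by (simp only: meijer_G_def * integral_mult_right_zero) simp
qed

lemma radial_conv_cauchy_antimono:
  assumes "\<nu> 1 = 0" "0 \<le> r" "r \<le> r'"
  shows "radial_conv (\<lambda>j r. ennreal (cauchy_factor N (\<nu> j) r)) m r' \<le>
    radial_conv (\<lambda>j r. ennreal (cauchy_factor N (\<nu> j) r)) m r"
  using assms(2,3)
  by (intro radial_conv_antimono) (simp_all add: assms(1)[unfolded One_nat_def] ennreal_leI cauchy_factor_0_antimono)

lemma radial_conv_cauchy_tendsto:
  assumes "\<nu> 1 = 0" "0 < a"
  shows "(radial_conv (\<lambda>j r. ennreal (cauchy_factor N (\<nu> j) r)) m \<longlongrightarrow>
    radial_conv (\<lambda>j r. ennreal (cauchy_factor N (\<nu> j) r)) m a) (at a)" (is "(?W \<longlongrightarrow> _) _")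
proof (rule tendsto_of_antimono_scaling)
  show "?W r' \<le> ?W r" if "0 < r" "r \<le> r'" for r r'
    using that assms(1) by (intro radial_conv_cauchy_antimono) auto
  show "?W r \<le> ennreal (l ^ (N + 1)) * ?W (l * r)" if "1 \<le> l" "0 < r" for l r
  proof (rule radial_conv_scaling)
    fix r :: real assume "0 \<le> r"
    then show "ennreal (cauchy_factor N (\<nu> 1) r) \<le> ennreal (l ^ (N + 1)) * ennreal (cauchy_factor N (\<nu> 1) (l * r))"
      using \<open>1 \<le> l\<close> cauchy_factor_0_scaling[of l r N] unfolding assms(1)
      by (simp add: ennreal_leI cauchy_factor_nonneg del: power_Suc flip: ennreal_mult)
  qed (use that in simp_all)
qed fact

text \<open>Mellin inversion on Re s = c: the density exp(c y) W(exp y) has a constant times the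
  Gamma product at c + i t as characteristic function. Fourier inversion recovers it, and the
  exponential factor is then divided out.\<close>

lemma radial_conv_eq_meijer_G:
  fixes N m :: nat and \<nu> :: "nat \<Rightarrow> nat" and c x :: real
  assumes "0 < c" "c < real N + 1" and "\<nu> 1 = 0" and "0 < x"
  defines "W \<equiv> radial_conv (\<lambda>j r. ennreal (cauchy_factor N (\<nu> j) r)) m"
  shows "W x < \<infinity>"
    and "complex_of_real (enn2real (W x)) =
      of_real (pi ^ m / (\<Prod>i=1..Suc m. Gamma (real (\<nu> i) + real N + 1))) *
      meijer_G (Suc m) (\<lambda>j. - of_nat N) (\<lambda>j. of_nat (\<nu> j)) c x"
proof -
  let ?f = "\<lambda>j r. ennreal (cauchy_factor N (\<nu> j) r)"
  let ?M = "density lborel (\<lambda>y. ennreal (exp (c * y)) * W (exp y))"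
  let ?G = "\<lambda>j t. Gamma (Complex (\<nu> j + c) t) * Gamma (Complex (real N + 1 - c) (- t))"
  define C where "C = pi ^ m / (\<Prod>i=1..Suc m. Gamma (real (\<nu> i) + real N + 1))"
  have [measurable]: "W \<in> borel_measurable borel"
    unfolding W_def by measurable
  have anti: "?f 1 r' \<le> ?f 1 r" if "0 \<le> r" "r \<le> r'" for r r'
    using that \<open>\<nu> 1 = 0\<close> by (simp add: ennreal_leI cauchy_factor_0_antimono)
  have chars: "finite_measure ?M \<and> char ?M t = of_real (pi ^ m) *
      (\<Prod>j=1..Suc m. char (density lborel (\<lambda>u. ennreal (exp (c * u)) * ?f j (exp u))) t)" for t
    unfolding W_def by (intro radial_conv_char cauchy_factor_char assms) simp
  then have fin: "finite_measure ?M"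
    by blast
  have char_M: "char ?M t = of_real C * (\<Prod>j=1..Suc m. ?G j t)" for t
    using chars[of t] assms(1,2)
    by (simp add: cauchy_factor_char C_def prod_dividef del: prod.cl_ivl_Suc)
  have W_fin: "W r < \<infinity>" if "0 < r" for r
    using fin that unfolding W_def by (intro radial_conv_finite[of ?f c m] anti) simp_all
  then show "W x < \<infinity>"
    using \<open>0 < x\<close> by blast
  \<comment> \<open>\<open>W\<close> is finite on positive arguments, so passing to real values
    loses nothing.\<close>
  define \<phi> where "\<phi> = (\<lambda>y. exp (c * y) * enn2real (W (exp y)))"
  have \<phi>: "ennreal (exp (c * y)) * W (exp y) = ennreal (\<phi> y)" for y
    using W_fin[of "exp y"] by (simp add: \<phi>_def ennreal_mult less_top)
  note fin = fin[unfolded \<phi>] and char_M = char_M[unfolded \<phi>]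
  have inv: "complex_of_real (\<phi> y) = 1 / (2 * pi) * (CLBINT t. iexp (- (t * y)) * char (density lborel \<phi>) t)" for y
  proof (rule char_inversion_finite_density[OF fin])
    show "continuous_on UNIV \<phi>"
    proof -
      have "isCont (\<lambda>r. enn2real (W r)) a" if "0 < a" for a
        unfolding isCont_def using W_fin[OF that]
          radial_conv_cauchy_tendsto[of \<nu> a N m] \<open>\<nu> 1 = 0\<close> that
        by (intro tendsto_enn2real) (simp_all add: W_def less_top)
      then have "isCont (\<lambda>y. enn2real (W (exp y))) y" for y
        by (intro isCont_o2[where f = exp and g = "\<lambda>r. enn2real (W r)"]) simp_all
      then show ?thesis
        unfolding \<phi>_def by (intro continuous_at_imp_continuous_on ballI continuous_intros)
    qed
    show "0 \<le> \<phi> y" for y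
      by (simp add: \<phi>_def)
    \<comment> \<open>At t = 0 every factor is a product of Gamma values at positive reals, so the
      total mass is nonzero.\<close>
    have Gamma_pos: "0 < Gamma (\<nu> j + c)" "0 < Gamma (real N + 1 - c)" "0 < Gamma (real (\<nu> j) + real N + 1)" for j
      using assms by (simp_all add: Gamma_real_pos)
    have "?G j 0 = of_real (Gamma (\<nu> j + c) * Gamma (real N + 1 - c))" for j
      by (simp flip: complex_of_real_def Gamma_complex_of_real)
    moreover have "Gamma (\<nu> j + c) * Gamma (real N + 1 - c) \<noteq> 0" "Gamma (real (\<nu> j) + real N + 1) \<noteq> 0" for j
      by (metis Gamma_pos less_irrefl mult_pos_pos)+
    ultimately show "char (density lborel \<phi>) 0 \<noteq> 0"
      unfolding char_M C_def by (simp only: mult_eq_0_iff divide_eq_0_iff of_real_eq_0_iff) simp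
    show "integrable lborel (char (density lborel \<phi>))"
    proof (rule Bochner_Integration.integrable_bound)
      \<comment> \<open>Quadratic decay of one factor suffices: it is taken from
        \<open>j = 1\<close>, where \<nu> vanishes, and every other Gamma value is bounded by its
        value at t = 0.\<close>
      let ?B = "C * (Gamma (c + 2) * Gamma (real N + 1 - c)) * (\<Prod>j=2..Suc m. Gamma (\<nu> j + c) * Gamma (real N + 1 - c))"
      show "integrable lborel (\<lambda>t. ?B * (1 / (c\<^sup>2 + t\<^sup>2)))"
        using integrable_inverse_sum_squares[OF \<open>0 < c\<close>] by (intro integrable_mult_right)
      interpret finite_measure "density lborel \<phi>" by (rule fin)
      show "char (density lborel \<phi>) \<in> borel_measurable lborel"
        unfolding char_def by measurable
      show "AE t in lborel. norm (char (density lborel \<phi>) t) \<le> norm (?B * (1 / (c\<^sup>2 + t\<^sup>2)))"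
      proof (intro AE_I2)
        fix t
        have "0 \<le> C"
          unfolding C_def using Gamma_pos by (intro divide_nonneg_nonneg prod_nonneg) (auto intro: less_imp_le)
        have "norm (char (density lborel \<phi>) t) = C * (norm (?G 1 t) * (\<Prod>j=2..Suc m. norm (?G j t)))"
          unfolding char_M norm_mult[of "of_real C"] prod_norm[symmetric]
          using \<open>0 \<le> C\<close> by (subst prod.atLeast_Suc_atMost) (simp_all add: numeral_2_eq_2 del: prod.cl_ivl_Suc)
        also have "\<dots> \<le> C * ((Gamma (c + 2) * (1 / (c\<^sup>2 + t\<^sup>2)) * Gamma (real N + 1 - c)) *
            (\<Prod>j=2..Suc m. Gamma (\<nu> j + c) * Gamma (real N + 1 - c)))"
        proof (intro mult_left_mono mult_mono prod_mono conjI \<open>0 \<le> C\<close>)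
          show "norm (?G 1 t) \<le> Gamma (c + 2) * (1 / (c\<^sup>2 + t\<^sup>2)) * Gamma (real N + 1 - c)"
            unfolding norm_mult using norm_Gamma_Complex_decay[OF \<open>0 < c\<close>, of t] assms
            by (intro mult_mono norm_Gamma_Complex_le) (simp_all add: Gamma_real_pos less_imp_le)
          show "norm (?G j t) \<le> Gamma (\<nu> j + c) * Gamma (real N + 1 - c)" for j
            unfolding norm_mult using Gamma_pos(1)[of j] Gamma_pos(2) assms
            by (intro mult_mono norm_Gamma_Complex_le) (simp_all add: less_imp_le)
        qed (use assms in \<open>auto intro!: prod_nonneg simp: Gamma_real_pos less_imp_le simp del: prod.cl_ivl_Suc\<close>)
        also have "\<dots> = ?B * (1 / (c\<^sup>2 + t\<^sup>2))"
          by (simp add: mult_ac)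
        finally show "norm (char (density lborel \<phi>) t) \<le> norm (?B * (1 / (c\<^sup>2 + t\<^sup>2)))"
          unfolding real_norm_def by (rule order_trans[OF _ abs_ge_self])
      qed
    qed
  qed
  define y where "y = ln x"
  have x: "x = exp y"
    using \<open>0 < x\<close> by (simp add: y_def)
  have "complex_of_real (enn2real (W x)) = of_real (exp (- c * y)) * of_real (\<phi> y)"
    by (simp add: x \<phi>_def flip: of_real_mult exp_add mult.assoc)
  also have "\<dots> = of_real C * meijer_G (Suc m) (\<lambda>j. - of_nat N) (\<lambda>j. of_nat (\<nu> j)) c x"
    unfolding inv char_M x meijer_G_exp
    by (simp add: mult.left_commute[of _ "complex_of_real C"] del: prod.cl_ivl_Suc)
  finally show "complex_of_real (enn2real (W x)) =
      of_real (pi ^ m / (\<Prod>i=1..Suc m. Gamma (real (\<nu> i) + real N + 1))) *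
      meijer_G (Suc m) (\<lambda>j. - of_nat N) (\<lambda>j. of_nat (\<nu> j)) c x"
    by (simp only: C_def)
qed

text \<open>For each fixed \<epsilon>, the pushforward formula with the nascent delta as test
  function turns the integral over C^n into a planar average of the radial profile
  \<open>W\<close>.\<close>

lemma has_delta_integral_weight:
  fixes N m :: nat and \<nu> :: "nat \<Rightarrow> nat"
  defines "W \<equiv> radial_conv (\<lambda>j r. ennreal (cauchy_factor N (\<nu> j) r)) m"
  assumes "((\<lambda>w. W ((norm w)\<^sup>2)) \<longlongrightarrow> L) (at z)"
  shows "has_delta_integral (lebesgue_Cn (Suc m)) (weight_integrand (Suc m) N \<nu>) (\<lambda>x. \<Prod>j=1..Suc m. x j) z L"
  unfolding has_delta_integral_def
proof (intro allI impI)
  fix \<eta> assume \<eta>: "mollifier \<eta>"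
  then have nonneg: "0 \<le> \<eta> w" for w
    by (simp add: mollifier_def)
  have [measurable]: "\<eta> \<in> borel_measurable borel"
    using \<eta> by (intro borel_measurable_continuous_onI) (simp add: mollifier_def)
  have [measurable]: "W \<in> borel_measurable borel"
    unfolding W_def by measurable
  have integrand: "weight_integrand (Suc m) N \<nu> x = (\<Prod>j=1..Suc m. cauchy_factor N (\<nu> j) ((norm (x j))\<^sup>2))" for x
    unfolding weight_integrand_def cauchy_factor_def power_mult ..
  have "(\<integral>\<^sup>+x. ennreal (weight_integrand (Suc m) N \<nu> x * (\<eta> ((z - (\<Prod>j=1..Suc m. x j)) / complex_of_real \<epsilon>) / \<epsilon>\<^sup>2))
        \<partial>lebesgue_Cn (Suc m)) =
      (\<integral>\<^sup>+w. ennreal (\<eta> ((z - w) / complex_of_real \<epsilon>) / \<epsilon>\<^sup>2) * W ((norm w)\<^sup>2) \<partial>lborel)" for \<epsilon>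
    unfolding W_def
    by (subst nn_integral_radial_conv[symmetric])
       (auto intro!: nn_integral_cong simp: integrand nonneg cauchy_factor_nonneg prod_ennreal prod_nonneg
          mult.commute simp del: prod.cl_ivl_Suc simp flip: ennreal_mult)
  then show "((\<lambda>\<epsilon>. \<integral>\<^sup>+x. ennreal (weight_integrand (Suc m) N \<nu> x *
        (\<eta> ((z - (\<Prod>j=1..Suc m. x j)) / complex_of_real \<epsilon>) / \<epsilon>\<^sup>2)) \<partial>lebesgue_Cn (Suc m)) \<longlongrightarrow> L) (at_right 0)"
    using nn_integral_mollifier_tendsto[OF _ \<eta> assms(2)] by simp
qed


text \<open>The first conjunct certifies that \<open>weight\<close> is a genuine delta integral
  rather than a default value of the definite description. At z = 0 the value may be infinite and
  the Mellin-Barnes formula is meaningful only for positive arguments, hence the limit in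
  [0, \<infinity>].\<close>

theorem proposition2p1:
  fixes n N :: nat and \<nu> :: "nat \<Rightarrow> nat" and c :: real and z :: complex
  assumes "n \<ge> 1" and "N \<ge> 1"
    and "\<nu> 1 = 0" and "\<And>i. 1 \<le> i \<Longrightarrow> i < n \<Longrightarrow> \<nu> i \<le> \<nu> (i + 1)"
    and "separating_line n (\<lambda>j. - of_nat N) (\<lambda>j. of_nat (\<nu> j)) c"
  shows
    "let K = pi ^ (n - 1) / (\<Prod>i=1..n. Gamma (real (\<nu> i) + real N + 1));
         G = meijer_G n (\<lambda>j. - of_nat N) (\<lambda>j. of_nat (\<nu> j)) c
     in has_delta_integral (lebesgue_Cn n) (weight_integrand n N \<nu>) (\<lambda>x. \<Prod>j=1..n. x j) z
          (weight n N \<nu> z) \<and>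
        (z \<noteq> 0 \<longrightarrow>
           weight n N \<nu> z < \<infinity> \<and>
           complex_of_real (enn2real (weight n N \<nu> z)) = of_real K * G ((norm z)\<^sup>2)) \<and>
        (z = 0 \<longrightarrow>
           ((\<lambda>x. ennreal (Re (of_real K * G x))) \<longlongrightarrow> weight n N \<nu> z) (at_right 0))"
proof -
  obtain m where n: "n = Suc m"
    using \<open>n \<ge> 1\<close> by (cases n) auto
  define W where "W = radial_conv (\<lambda>j r. ennreal (cauchy_factor N (\<nu> j) r)) m"
  define K where "K = pi ^ m / (\<Prod>i=1..n. Gamma (real (\<nu> i) + real N + 1))"
  define G where "G = meijer_G n (\<lambda>j. - of_nat N) (\<lambda>j. of_nat (\<nu> j)) c"
  \<comment> \<open>For z = 0 only values of \<open>W\<close> at positive arguments enter: the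
    supremum is the limit of the decreasing profile.\<close>
  define L where "L = (if z = 0 then (SUP r\<in>{0<..}. W r) else W ((norm z)\<^sup>2))"
  \<comment> \<open>The instance j = 1, k = 0 already confines c to the strip, because \<nu>
    vanishes at 1 and every upper parameter is -N.\<close>
  from assms(5) have "Re (- of_nat (\<nu> 1) - of_nat 0) < c \<and> c < Re (1 - (- of_nat N) + of_nat 0)"
    unfolding separating_line_def using \<open>n \<ge> 1\<close> by (metis atLeastAtMost_iff order_refl)
  then have c: "0 < c" "c < real N + 1"
    using \<open>\<nu> 1 = 0\<close> by simp_all
  have W_eq: "W x < \<infinity>" "complex_of_real (enn2real (W x)) = of_real K * G x" if "0 < x" for x
    using radial_conv_eq_meijer_G[of c N \<nu> x m] c \<open>\<nu> 1 = 0\<close> that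
    unfolding W_def K_def G_def n by blast+
  have lim_0: "(W \<longlongrightarrow> (SUP r\<in>{0<..}. W r)) (at_right 0)"
  proof (rule tendsto_at_right_SUP_antimono)
    show "W r' \<le> W r" if "0 < r" "r \<le> r'" for r r'
      unfolding W_def using that \<open>\<nu> 1 = 0\<close> by (intro radial_conv_cauchy_antimono) auto
  qed
  have "((\<lambda>w. W ((norm w)\<^sup>2)) \<longlongrightarrow> L) (at z)"
  proof (cases "z = 0")
    case True
    \<comment> \<open>In the punctured neighbourhood of 0, |w|^2 approaches 0 through positive
      values, so the value of \<open>W\<close> at 0 never enters.\<close>
    have "filterlim (\<lambda>w::complex. (norm w)\<^sup>2) (at_right 0) (at 0)"
      by (auto simp: filterlim_at eventually_at_filter intro!: tendsto_eq_intros)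
    with lim_0 have "((\<lambda>w::complex. W ((norm w)\<^sup>2)) \<longlongrightarrow> (SUP r\<in>{0<..}. W r)) (at 0)"
      by (rule filterlim_compose)
    then show ?thesis
      by (simp add: L_def True)
  next
    case False
    have "isCont W ((norm z)\<^sup>2)"
      unfolding isCont_def W_def using False \<open>\<nu> 1 = 0\<close> by (intro radial_conv_cauchy_tendsto) simp_all
    then have "isCont (\<lambda>w. W ((norm w)\<^sup>2)) z"
      by (intro isCont_o2[where f = "\<lambda>w. (norm w)\<^sup>2" and g = W] continuous_intros)
    then show ?thesis
      by (simp add: L_def False isCont_def)
  qed
  then have delta: "has_delta_integral (lebesgue_Cn n) (weight_integrand n N \<nu>) (\<lambda>x. \<Prod>j=1..n. x j) z L"
    unfolding W_def n by (rule has_delta_integral_weight)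
  then have weight: "weight n N \<nu> z = L"
    unfolding weight_def by (rule delta_integral_eqI)
  have "((\<lambda>x. ennreal (Re (of_real K * G x))) \<longlongrightarrow> (SUP r\<in>{0<..}. W r)) (at_right 0)"
  proof (rule Lim_transform_eventually[OF lim_0])
    show "\<forall>\<^sub>F x in at_right 0. W x = ennreal (Re (of_real K * G x))"
      using eventually_at_right_less[of 0]
    proof eventually_elim
      \<comment> \<open>Finiteness of W x allows it to be recovered from the real part of the
        complex identity.\<close>
      case (elim x)
      then show ?case
        using W_eq[of x] by (metis Re_complex_of_real ennreal_enn2real infinity_ennreal_def)
    qed
  qed
  then show ?thesis
    unfolding Let_def weight K_def[symmetric] G_def[symmetric]
    using delta W_eq[of "(norm z)\<^sup>2"]
    by (simp add: K_def[unfolded n] G_def[symmetric] L_def n)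
qed

end
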